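(* Let $(p_k)_{k\ge 0}$ be real numbers with $p_k\ge 0$ and $\sum_{k=0}^\infty p_k=1$, and let $(X_n)_{n\ge 0}$ be the random walk on $\{0,1,2,\dots\}$ with jump distribution $(p_k)$ at the origin. Assume: (A1) $p_0<1$; (A2) there exists an even $k\ge 0$ with $p_k>0$; (A3) there exists $N>0$ such that $p_k=0$ for all $k>N$; (A4) the polynomial $\phi(x)=x^2+1-2x\sum_{k\ge 0}p_kx^k$ has no repeated roots (in $\mathbb{C}$). Then for every fixed integer $j\ge 0$, as $n\to\infty$, $$E(X_n\mid X_0=j)=\frac{2}{\sqrt{2\pi}}\sqrt{n}+\frac{E(Y^2)-1}{2E(Y)}+\frac{1}{\sqrt{2\pi}}\left[\frac13-\frac{E(Y^3)}{3E(Y)}+\frac{(E(Y^2)-1)^2}{2(E(Y))^2}-j\,\frac{E(Y^2)-1}{E(Y)}+j^2\right]\frac{1}{\sqrt n}+O\left(\frac{1}{n^{3/2}}\right).$$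
   Context: The random walk $(X_n)_{n\ge0}$ is the discrete-time, time-homogeneous Markov chain on $\{0,1,2,\dots\}$ with transition probabilities $P(X_{n+1}=j-1\mid X_n=j)=P(X_{n+1}=j+1\mid X_n=j)=\frac12$ for $j\ge 1$, and $P(X_{n+1}=k\mid X_n=0)=p_k$ for $k\ge 0$. The expected position is $E(X_n\mid X_0=j)=\sum_{k=0}^\infty k\,P(X_n=k\mid X_0=j)$. $Y$ denotes a random variable with $P(Y=k)=p_k$ for $k=0,1,2,\dots$, so $E(Y^m)=\sum_{k=0}^\infty p_kk^m$. *)

theory Defs
  imports "HOL-Probability.Probability" "HOL-Computational_Algebra.Polynomial"
    "HOL-Library.Landau_Symbols"
begin

text \<open>Discrete-time, time-homogeneous Markov chains on the natural numbers with transition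
  probabilities \<open>K i k\<close> (from \<open>i\<close> to \<open>k\<close>). The initial distribution is left arbitrary. The
  Markov property is only required for histories of positive probability, because
  \<^const>\<open>cond_prob\<close> takes the value 0 when conditioning on a null event.\<close>

locale homogeneous_markov_chain = prob_space M
  for M :: "'a measure" +
  fixes X :: "nat \<Rightarrow> 'a \<Rightarrow> nat" and K :: "nat \<Rightarrow> nat \<Rightarrow> real"
  assumes random_variable_X: "\<And>n. random_variable (count_space UNIV) (X n)"
    and markov: "\<And>n x k. \<P>(\<omega> in M. \<forall>i\<le>n. X i \<omega> = x i) > 0 \<Longrightarrow>
      \<P>(\<omega> in M. X (Suc n) \<omega> = k \<bar> \<forall>i\<le>n. X i \<omega> = x i) = K (x n) k"

definition walk_transition :: "(nat \<Rightarrow> real) \<Rightarrow> nat \<Rightarrow> nat \<Rightarrow> real" where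
  "walk_transition p j k =
    (if j = 0 then p k else if k = j - 1 \<or> k = j + 1 then 1 / 2 else 0)"

definition random_walk :: "'a measure \<Rightarrow> (nat \<Rightarrow> 'a \<Rightarrow> nat) \<Rightarrow> (nat \<Rightarrow> real) \<Rightarrow> bool" where
  "random_walk M X p \<longleftrightarrow> homogeneous_markov_chain M X (walk_transition p)"

definition expected_position :: "'a measure \<Rightarrow> (nat \<Rightarrow> 'a \<Rightarrow> nat) \<Rightarrow> nat \<Rightarrow> nat \<Rightarrow> real" where
  "expected_position M X j n =
    (\<Sum>k. real k * \<P>(\<omega> in M. X n \<omega> = k \<bar> X 0 \<omega> = j))"

definition moment :: "(nat \<Rightarrow> real) \<Rightarrow> nat \<Rightarrow> real" where
  "moment p m = (\<Sum>k. p k * real k ^ m)"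

text \<open>The polynomial \<open>x\<^sup>2 + 1 - 2 x (\<Sum>k. p k x\<^sup>k)\<close> over the complex numbers, for a sequence
  \<open>p\<close> that vanishes beyond \<open>N\<close>.\<close>

definition walk_poly :: "(nat \<Rightarrow> real) \<Rightarrow> nat \<Rightarrow> complex poly" where
  "walk_poly p N = [:1, 0, 1:] - [:0, 2:] * (\<Sum>k\<le>N. monom (complex_of_real (p k)) k)"

end

theory Submission
  imports Defs "HOL-Complex_Analysis.Complex_Analysis" "HOL-Real_Asymp.Real_Asymp"
begin

text \<open>
  Write \<open>e n i\<close> for the mean position after \<open>n\<close> steps from \<open>i\<close> (\<open>walk_mean\<close>). Conditioning on the
  first step turns the Markov property into a recursion for \<open>e\<close>, and the recursion determines the
  generating function \<open>G\<^sub>j(z) = (\<Sum>n. e n j * z^n)\<close> in closed form. The only transcendental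
  ingredient is \<open>h = hit z\<close>, the generating function of the time at which the simple random walk
  goes from 1 to 0; it satisfies \<open>z * (1 + h\<^sup>2) = 2 * h\<close>, so that \<open>z\<close> is a rational function of \<open>h\<close>
  and \<open>G\<^sub>j\<close> becomes a rational function of \<open>h\<close>. Its denominator is built from the polynomial
  \<open>\<phi>(h) = h\<^sup>2 + 1 - 2*h*P(h)\<close>, where \<open>P\<close> is the generating polynomial of the jumps from the origin.

  On the closed unit disc \<open>h\<close> has modulus below 1 except at the branch points \<open>z = 1\<close> and \<open>z = -1\<close>,
  which it fixes. Since \<open>\<phi>(h) = (1 + h\<^sup>2) * (1 - z * P(h))\<close>, a zero of
  \<open>\<phi>(h)\<close> on the closed disc forces \<open>z = 1\<close>: away from the branch points \<open>|P(h)| < 1\<close>, because the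
  walk leaves the origin, and at \<open>z = -1\<close> an even jump of positive probability gives \<open>P(-1) > -1\<close>. The zero at 1
  is simple, as \<open>\<phi>'(1) = -2*E(Y)\<close>. Hence \<open>G\<^sub>j\<close> has a pole of order three in \<open>h\<close> at \<open>h = 1\<close>, and apart
  from its polar part it is a quotient of polynomials in \<open>h\<close> whose denominator does not vanish on the
  closed disc (\<open>mean_gf_decomposition\<close>).

  Such a regular quotient has Taylor coefficients of order \<open>n powr (-3/2)\<close>
  (\<open>coeff_decay_rational_hit\<close>): modulo polynomials in \<open>h\<close> it is divisible by \<open>(1 - h\<^sup>2)^4\<close>, and
  this factor compensates the singularities of \<open>h\<close> at the two branch points, so the second
  derivative in \<open>z\<close> stays bounded and Cauchy's inequality applies.

  The polar part is expressed by \<open>tau z = (1 + h) / (1 - h)\<close>, a square root of \<open>(1 + z) / (1 - z)\<close>.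
  The coefficients of \<open>tau\<close> and \<open>tau^3\<close> are elementary multiples of the probability
  \<open>(2*m choose m) / 4^m\<close> that a simple random walk is back at its start after \<open>2*m\<close> steps, whose
  second order asymptotics follow from Wallis' product. The powers \<open>tau^3\<close>, \<open>tau\<^sup>2\<close> and \<open>tau\<close>
  contribute the terms of order \<open>sqrt n\<close>, \<open>1\<close> and \<open>1 / sqrt n\<close>, and the coefficients in front
  of them come from the derivatives of \<open>\<phi>\<close> at 1, that is, from the moments of \<open>Y\<close>.
\<close>

section \<open>Taylor coefficients of functions holomorphic on the unit disc\<close>

definition taylor_coeff :: "(complex \<Rightarrow> complex) \<Rightarrow> nat \<Rightarrow> complex" where
  "taylor_coeff f n = fps_nth (fps_expansion f 0) n"

lemma holomorphic_disc_expansion: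
  "f holomorphic_on ball 0 1 \<Longrightarrow> f has_fps_expansion fps_expansion f 0"
  by (rule has_fps_expansion_fps_expansion[of "ball 0 1"]) auto

lemma taylor_coeff_eqI: "f has_fps_expansion F \<Longrightarrow> taylor_coeff f n = fps_nth F n"
  unfolding taylor_coeff_def by (simp add: fps_expansion_eqI)

lemma taylor_coeff_const: "taylor_coeff (\<lambda>_. c) n = (if n = 0 then c else 0)"
  by (subst taylor_coeff_eqI[of _ "fps_const c"]) auto

lemma taylor_coeff_0: "taylor_coeff f 0 = f 0"
  by (simp add: taylor_coeff_def fps_expansion_def)

lemma taylor_coeff_cong:
  "(\<And>z. z \<in> ball 0 1 \<Longrightarrow> f z = g z) \<Longrightarrow> taylor_coeff f n = taylor_coeff g n"
  unfolding taylor_coeff_def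
  by (subst fps_expansion_cong[of f g]) (auto simp: eventually_nhds intro!: exI[of _ "ball 0 1"])

lemma taylor_coeff_add:
  assumes "f holomorphic_on ball 0 1" "g holomorphic_on ball 0 1"
  shows "taylor_coeff (\<lambda>z. f z + g z) n = taylor_coeff f n + taylor_coeff g n"
  by (subst taylor_coeff_eqI[OF has_fps_expansion_add[OF assms[THEN holomorphic_disc_expansion]]])
     (simp add: taylor_coeff_def)

lemma taylor_coeff_cmult:
  assumes "f holomorphic_on ball 0 1"
  shows "taylor_coeff (\<lambda>z. c * f z) n = c * taylor_coeff f n"
  by (subst taylor_coeff_eqI[OF has_fps_expansion_cmult_left[OF assms[THEN holomorphic_disc_expansion]]])
     (simp add: taylor_coeff_def)

lemma taylor_coeff_sum:
  assumes "\<And>i. i \<in> A \<Longrightarrow> f i holomorphic_on ball 0 1"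
  shows "taylor_coeff (\<lambda>z. \<Sum>i\<in>A. f i z) n = (\<Sum>i\<in>A. taylor_coeff (f i) n)"
proof -
  have "(\<lambda>z. \<Sum>i\<in>A. f i z) has_fps_expansion (\<Sum>i\<in>A. fps_expansion (f i) 0)"
    using assms by (intro has_fps_expansion_sum holomorphic_disc_expansion)
  from taylor_coeff_eqI[OF this] show ?thesis by (simp add: fps_sum_nth taylor_coeff_def)
qed

lemma taylor_coeff_shift:
  assumes "f holomorphic_on ball 0 1"
  shows "taylor_coeff (\<lambda>z. z * f z) (Suc n) = taylor_coeff f n"
  by (subst taylor_coeff_eqI[OF has_fps_expansion_mult[OF has_fps_expansion_fps_X
       assms[THEN holomorphic_disc_expansion]]]) (simp add: taylor_coeff_def)

lemma taylor_coeff_deriv: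
  assumes "f holomorphic_on ball 0 1"
  shows "taylor_coeff (deriv f) n = of_nat (Suc n) * taylor_coeff f (Suc n)"
  by (subst taylor_coeff_eqI[OF has_fps_expansion_deriv[OF assms[THEN holomorphic_disc_expansion]]])
     (simp add: taylor_coeff_def)

text \<open>Cauchy's inequality on the circles of radius \<open>r < 1\<close>, with \<open>r\<close> tending to 1, because \<open>f\<close> need not
  extend to the unit circle.\<close>
lemma norm_taylor_coeff_le:
  assumes hol: "f holomorphic_on ball 0 1" and B: "\<And>z. z \<in> ball 0 1 \<Longrightarrow> norm (f z) \<le> B"
  shows "norm (taylor_coeff f n) \<le> B"
proof -
  have bd: "norm (taylor_coeff f n) * r ^ n \<le> B" if r: "0 < r" "r < 1" for r
  proof -
    have sub: "cball 0 r \<subseteq> ball (0::complex) 1" "ball 0 r \<subseteq> ball (0::complex) 1" using r by auto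
    have "norm ((deriv ^^ n) f 0) \<le> fact n * B / r ^ n"
    proof (rule Cauchy_inequality)
      show "f holomorphic_on ball 0 r" using hol sub holomorphic_on_subset by blast
      show "continuous_on (cball 0 r) f"
        using hol sub holomorphic_on_subset holomorphic_on_imp_continuous_on by blast
    qed (use r B in auto)
    thus ?thesis using r
      by (simp add: taylor_coeff_def fps_expansion_def norm_divide field_simps)
  qed
  have lim: "((\<lambda>r. norm (taylor_coeff f n) * r ^ n) \<longlongrightarrow> norm (taylor_coeff f n) * 1 ^ n) (at_left 1)"
    by (intro tendsto_intros)
  have "norm (taylor_coeff f n) * 1 ^ n \<le> B"
    by (rule tendsto_upperbound[OF lim])
       (auto intro!: bd eventually_mono[OF eventually_at_left_real[of 0 1]])
  thus ?thesis by simp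
qed

lemma taylor_coeff_geometric: "taylor_coeff (\<lambda>z. 1 / (1 - z)) n = 1"
proof (induction n)
  case (Suc n)
  have hol: "(\<lambda>z::complex. 1 / (1 - z)) holomorphic_on ball 0 1"
    by (intro holomorphic_intros) auto
  have "taylor_coeff (\<lambda>z. 1 / (1 - z)) (Suc n) = taylor_coeff (\<lambda>z. 1 + z * (1 / (1 - z))) (Suc n)"
  proof (rule taylor_coeff_cong)
    fix z :: complex assume "z \<in> ball 0 1"
    hence "1 - z \<noteq> 0" by auto
    thus "1 / (1 - z) = 1 + z * (1 / (1 - z))" by (simp add: field_simps)
  qed
  also have "\<dots> = taylor_coeff (\<lambda>z. z * (1 / (1 - z))) (Suc n)"
    by (subst taylor_coeff_add) (use hol in \<open>auto intro!: holomorphic_intros simp: taylor_coeff_const\<close>)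
  also have "\<dots> = 1" by (simp only: taylor_coeff_shift[OF hol] Suc)
  finally show ?case .
qed (simp add: taylor_coeff_0)

section \<open>The passage time generating function of the simple random walk\<close>

definition disc_root :: "complex \<Rightarrow> complex" where
  "disc_root z = csqrt (1 - z ^ 2)"

text \<open>The generating function \<open>(1 - sqrt (1 - z\<^sup>2)) / z\<close> of the passage time from 1 to 0 of the simple
  random walk, written so that it is regular at 0.\<close>
definition hit :: "complex \<Rightarrow> complex" where
  "hit z = z / (1 + disc_root z)"

text \<open>A square root of \<open>(1 + z) / (1 - z)\<close>. It equals \<open>(1 + h) / (1 - h)\<close> with \<open>h = hit z\<close> and serves to express
  poles at \<open>h = 1\<close> by functions with explicit Taylor coefficients.\<close>
definition tau :: "complex \<Rightarrow> complex" where
  "tau z = (1 + z) / disc_root z"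

lemma disc_root_sq: "disc_root z ^ 2 = 1 - z ^ 2"
  by (simp add: disc_root_def)

lemma Re_disc_root_nonneg: "Re (disc_root z) \<ge> 0"
  using csqrt_principal[of "1 - z^2"] by (auto simp: disc_root_def)

lemma one_plus_disc_root_nonzero: "1 + disc_root z \<noteq> 0"
  using Re_disc_root_nonneg[of z] by (auto simp: complex_eq_iff)

lemma Re_one_minus_sq:
  assumes "norm z \<le> 1" shows "Re (1 - z\<^sup>2) \<ge> 0" and "norm z < 1 \<Longrightarrow> Re (1 - z\<^sup>2) > 0"
    and "Re (1 - z\<^sup>2) = 0 \<Longrightarrow> z = 1 \<or> z = -1"
proof -
  have *: "(norm z)\<^sup>2 = (Re z)\<^sup>2 + (Im z)\<^sup>2" by (simp add: cmod_power2)
  have **: "Re (1 - z\<^sup>2) = 1 - (Re z)\<^sup>2 + (Im z)\<^sup>2" by (simp add: power2_eq_square)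
  have 1: "(norm z)\<^sup>2 \<le> 1" using assms by (simp add: power_le_one)
  show "Re (1 - z\<^sup>2) \<ge> 0" using 1 * ** zero_le_power2[of "Im z"] by linarith
  show "Re (1 - z\<^sup>2) > 0" if "norm z < 1"
  proof -
    have "(norm z)\<^sup>2 < 1" using that by (simp add: power_less_one_iff abs_square_less_1)
    thus ?thesis using * ** zero_le_power2[of "Im z"] by linarith
  qed
  show "z = 1 \<or> z = -1" if "Re (1 - z\<^sup>2) = 0"
  proof -
    have "(Im z)\<^sup>2 = 0" "(Re z)\<^sup>2 = 1" using that 1 * ** zero_le_power2[of "Im z"] by linarith+
    thus ?thesis by (auto simp: complex_eq_iff power2_eq_1_iff)
  qed
qed

lemma Re_disc_root_pos:
  assumes "norm z \<le> 1" "z \<noteq> 1" "z \<noteq> -1"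
  shows "Re (disc_root z) > 0"
proof -
  have "Re (1 - z\<^sup>2) > 0" using Re_one_minus_sq[of z] assms by fastforce
  hence "1 - z\<^sup>2 \<notin> \<real>\<^sub>\<le>\<^sub>0" by (auto simp: complex_nonpos_Reals_iff)
  thus ?thesis unfolding disc_root_def using \<open>Re (1 - z\<^sup>2) > 0\<close>
    by (simp add: add_nonneg_pos)
qed

text \<open>First-step equation of the passage time: from 1 the walk moves to 0, or to 2, from where it has to
  descend twice.\<close>
lemma hit_eq: "z * (1 + (hit z)\<^sup>2) = 2 * hit z"
proof -
  have h: "hit z * (1 + disc_root z) = z"
    using one_plus_disc_root_nonzero[of z] by (simp add: hit_def)
  have "(1 + disc_root z)\<^sup>2 * (z * (1 + (hit z)\<^sup>2) - 2 * hit z)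
      = z * ((1 + disc_root z)\<^sup>2 + (hit z * (1 + disc_root z))\<^sup>2)
        - 2 * (hit z * (1 + disc_root z)) * (1 + disc_root z)"
    by (simp add: algebra_simps power2_eq_square)
  also have "\<dots> = 0" unfolding h using disc_root_sq[of z] by algebra
  finally show ?thesis using one_plus_disc_root_nonzero[of z] by simp
qed

lemma one_plus_hit_sq_nonzero: "1 + (hit z)\<^sup>2 \<noteq> 0"
  using hit_eq[of z] by auto

text \<open>With \<open>c = disc_root z\<close>, \<open>z\<^sup>2 = (1 - c) * (1 + c)\<close> gives \<open>|hit z|\<^sup>2 = |1 - c| / |1 + c|\<close>, and \<open>c\<close> lies
  in the open right half-plane.\<close>
lemma norm_hit_less_1:
  assumes "norm z \<le> 1" "z \<noteq> 1" "z \<noteq> -1"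
  shows "norm (hit z) < 1"
proof -
  let ?c = "disc_root z"
  have "z ^ 2 = (1 - ?c) * (1 + ?c)" using disc_root_sq[of z] by algebra
  hence sq: "(norm z)\<^sup>2 = norm (1 - ?c) * norm (1 + ?c)"
    by (metis norm_mult norm_power)
  have diff: "(norm (1 + ?c))\<^sup>2 - (norm (1 - ?c))\<^sup>2 = 4 * Re ?c"
    by (simp add: cmod_power2) algebra
  have pos: "norm (1 + ?c) > 0" using one_plus_disc_root_nonzero[of z] by simp
  have nh: "norm (hit z) = norm z / norm (1 + ?c)" by (simp add: hit_def norm_divide)
  from assms have "Re ?c > 0" by (rule Re_disc_root_pos)
  hence "(norm (1 - ?c))\<^sup>2 < (norm (1 + ?c))\<^sup>2" using diff by linarith
  hence "norm (1 - ?c) < norm (1 + ?c)" by (rule power2_less_imp_less) simp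
  hence "norm (1 - ?c) * norm (1 + ?c) < norm (1 + ?c) * norm (1 + ?c)"
    using pos by (rule mult_strict_right_mono)
  hence "(norm z)\<^sup>2 < (norm (1 + ?c))\<^sup>2" unfolding sq by (simp only: power2_eq_square)
  hence "norm z < norm (1 + ?c)" by (rule power2_less_imp_less) simp
  thus "norm (hit z) < 1" unfolding nh using pos by simp
qed

lemma hit_endpoints: "hit 1 = 1" "hit (-1) = -1"
  by (simp_all add: hit_def disc_root_def)

text \<open>On the closed disc \<open>1 - z\<^sup>2\<close> meets the branch cut of the square root only at 0, where the square
  root is still continuous.\<close>
lemma continuous_on_hit: "continuous_on (cball 0 1) hit"
proof -
  have csq: "isCont csqrt w" if "Re w \<ge> 0" "w = 0 \<or> Re w > 0" for w
  proof (cases "w = 0")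
    case True
    have "((\<lambda>x. norm (csqrt x)) \<longlongrightarrow> sqrt (norm (0::complex))) (at 0)"
      unfolding norm_csqrt by (intro tendsto_intros)
    hence "(csqrt \<longlongrightarrow> 0) (at 0)" by (simp add: tendsto_norm_zero_cancel)
    thus ?thesis using True by (simp add: isCont_def)
  next
    case False
    hence "w \<notin> \<real>\<^sub>\<le>\<^sub>0" using that by (auto simp: complex_nonpos_Reals_iff)
    thus ?thesis by (rule continuous_at_csqrt)
  qed
  have "isCont disc_root z" if "z \<in> cball 0 1" for z
  proof -
    have nz: "norm z \<le> 1" using that by simp
    have "1 - z^2 = 0 \<or> Re (1 - z^2) > 0" "Re (1 - z^2) \<ge> 0"
      using Re_one_minus_sq[OF nz] by force+
    hence "isCont csqrt (1 - z\<^sup>2)" using csq by blast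
    moreover have "isCont (\<lambda>z. 1 - z\<^sup>2) z" by (intro continuous_intros)
    ultimately show ?thesis unfolding disc_root_def by (rule isCont_o2[rotated])
  qed
  hence "continuous_on (cball 0 1) disc_root" by (simp add: continuous_at_imp_continuous_on)
  thus ?thesis unfolding hit_def
    by (intro continuous_intros) (auto simp: one_plus_disc_root_nonzero)
qed

lemma holomorphic_disc_root: "disc_root holomorphic_on ball 0 1"
  unfolding disc_root_def
proof (intro holomorphic_intros)
  fix z :: complex assume "z \<in> ball 0 1"
  hence "Re (1 - z\<^sup>2) > 0" using Re_one_minus_sq[of z] by simp
  thus "1 - z\<^sup>2 \<notin> \<real>\<^sub>\<le>\<^sub>0" by (auto simp: complex_nonpos_Reals_iff)
qed

lemma disc_root_nonzero: "z \<in> ball 0 1 \<Longrightarrow> disc_root z \<noteq> 0"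
  using Re_disc_root_pos[of z] by force

lemma holomorphic_hit [holomorphic_intros]: "hit holomorphic_on ball 0 1"
  unfolding hit_def by (intro holomorphic_intros holomorphic_disc_root) (simp add: one_plus_disc_root_nonzero)

lemma holomorphic_tau [holomorphic_intros]: "tau holomorphic_on ball 0 1"
  unfolding tau_def by (intro holomorphic_intros holomorphic_disc_root) (simp add: disc_root_nonzero)

lemma norm_hit_less_1': "z \<in> ball 0 1 \<Longrightarrow> norm (hit z) < 1"
  by (rule norm_hit_less_1) auto

lemma hit_neq_pm1: "z \<in> ball 0 1 \<Longrightarrow> 1 - hit z \<noteq> 0" "z \<in> ball 0 1 \<Longrightarrow> 1 - (hit z)\<^sup>2 \<noteq> 0"
  using norm_hit_less_1'[of z] by (auto simp: power2_eq_1_iff dest!: sym[of 1])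

lemma one_minus_z_eq_hit: "1 - z = (1 - hit z)\<^sup>2 / (1 + (hit z)\<^sup>2)"
  using hit_eq[of z] one_plus_hit_sq_nonzero[of z] by (simp add: field_simps power2_eq_square)

lemma inverse_one_minus_hit:
  assumes "z \<in> ball 0 1"
  shows "1 / (1 - hit z) = (tau z + 1) / 2"
proof -
  have c: "disc_root z \<noteq> 0" using assms by (rule disc_root_nonzero)
  have h: "hit z * (1 + disc_root z) = z"
    using one_plus_disc_root_nonzero[of z] by (simp add: hit_def)
  have t: "tau z * disc_root z = 1 + z" using c by (simp add: tau_def)
  have "disc_root z * (1 + disc_root z) * ((tau z + 1) * (1 - hit z) - 2)
      = (tau z * disc_root z + disc_root z) * (1 + disc_root z - hit z * (1 + disc_root z))
        - 2 * disc_root z * (1 + disc_root z)"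
    by (simp add: algebra_simps)
  also have "\<dots> = 0" unfolding h t using disc_root_sq[of z] by algebra
  finally have "(tau z + 1) * (1 - hit z) = 2" using c one_plus_disc_root_nonzero[of z] by simp
  thus ?thesis using hit_neq_pm1[OF assms] by (simp add: field_simps)
qed

lemma tau_sq: "z \<in> ball 0 1 \<Longrightarrow> (tau z)\<^sup>2 * (1 - z) = 1 + z"
proof -
  assume z: "z \<in> ball 0 1"
  have c: "disc_root z \<noteq> 0" using z by (rule disc_root_nonzero)
  have t: "tau z * disc_root z = 1 + z" using c by (simp add: tau_def)
  have "(1 + z) \<noteq> 0" using z by (auto simp: add_eq_0_iff)
  moreover have "(1 + z) * ((tau z)\<^sup>2 * (1 - z) - (1 + z)) = 0"
    using t disc_root_sq[of z] by algebra
  ultimately show ?thesis by simp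
qed

text \<open>Implicit differentiation of \<open>z * (1 + (hit z)\<^sup>2) = 2 * hit z\<close>. The derivative is rational in \<open>hit z\<close>
  with poles at the branch points only; this keeps derivatives of rational functions of \<open>hit\<close>
  inside that class.\<close>
lemma deriv_hit:
  assumes "z \<in> ball 0 1"
  shows "(hit has_field_derivative (1 + (hit z)\<^sup>2)\<^sup>2 / (2 * (1 - (hit z)\<^sup>2))) (at z)"
proof -
  have "hit field_differentiable at z"
    using holomorphic_hit assms by (meson holomorphic_on_imp_differentiable_at open_ball)
  then obtain d where d: "(hit has_field_derivative d) (at z)"
    by (auto simp: field_differentiable_def)
  have "((\<lambda>z. z * (1 + (hit z)\<^sup>2) - 2 * hit z) has_field_derivative
      1 + (hit z)\<^sup>2 + z * (2 * hit z * d) - 2 * d) (at z)"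
    by (rule derivative_eq_intros d refl | simp)+
  moreover have "(\<lambda>z. z * (1 + (hit z)\<^sup>2) - 2 * hit z) = (\<lambda>_. 0)" using hit_eq by auto
  ultimately have e: "1 + (hit z)\<^sup>2 + z * (2 * hit z * d) - 2 * d = 0"
    using DERIV_unique[OF _ DERIV_const] by metis
  have "2 * d * (1 - (hit z)\<^sup>2) = (1 + (hit z)\<^sup>2)\<^sup>2"
    using e hit_eq[of z] by algebra
  hence "d = (1 + (hit z)\<^sup>2)\<^sup>2 / (2 * (1 - (hit z)\<^sup>2))"
    using hit_neq_pm1[OF assms] by (simp add: field_simps)
  thus ?thesis using d by simp
qed

text \<open>The differential equation \<open>(1 - z\<^sup>2) * tau' = tau\<close>, in a form that can be read as a recursion for
  Taylor coefficients.\<close>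
lemma deriv_tau:
  assumes "z \<in> ball 0 1"
  shows "deriv tau z = tau z + z * (z * deriv tau z)"
proof -
  have "tau field_differentiable at z"
    using holomorphic_tau assms by (meson holomorphic_on_imp_differentiable_at open_ball)
  then have d: "(tau has_field_derivative deriv tau z) (at z)"
    by (simp add: DERIV_deriv_iff_field_differentiable)
  let ?d = "deriv tau z"
  have "((\<lambda>z. (tau z)\<^sup>2 * (1 - z) - (1 + z)) has_field_derivative
      2 * tau z * ?d * (1 - z) - (tau z)\<^sup>2 - 1) (at z)"
    by (rule derivative_eq_intros d refl | simp)+
  moreover have "((\<lambda>z. (tau z)\<^sup>2 * (1 - z) - (1 + z)) has_field_derivative 0) (at z)"
    by (rule has_field_derivative_transform_within_open[OF DERIV_const[of 0], of "ball 0 1"])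
       (use assms tau_sq in auto)
  ultimately have e: "2 * tau z * ?d * (1 - z) - (tau z)\<^sup>2 - 1 = 0" by (rule DERIV_unique)
  have nz: "1 + z \<noteq> 0" "1 - z \<noteq> 0" using assms by (auto simp: add_eq_0_iff)
  hence "tau z \<noteq> 0" using tau_sq[OF assms] by auto
  moreover have "2 * tau z * (1 - z) * (?d - (tau z + z * (z * ?d))) = 0"
    using e tau_sq[OF assms] by algebra
  ultimately show ?thesis using nz by simp
qed

section \<open>Coefficients of order \<open>n powr (-3/2)\<close>\<close>

definition coeff_decay :: "(complex \<Rightarrow> complex) \<Rightarrow> bool" where
  "coeff_decay f \<longleftrightarrow> f holomorphic_on ball 0 1 \<and>
     (\<lambda>n. norm (taylor_coeff f n)) \<in> O(\<lambda>n. 1 / real n powr (3/2))"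

lemma coeff_decay_holo: "coeff_decay f \<Longrightarrow> f holomorphic_on ball 0 1"
  by (simp add: coeff_decay_def)

lemma coeff_decay_cong:
  assumes "coeff_decay f" "\<And>z. z \<in> ball 0 1 \<Longrightarrow> f z = g z"
  shows "coeff_decay g"
proof -
  have "taylor_coeff f = taylor_coeff g" by (rule ext, rule taylor_coeff_cong) (use assms in auto)
  moreover have "g holomorphic_on ball 0 1"
    using assms holomorphic_transform coeff_decay_def by blast
  ultimately show ?thesis using assms(1) by (simp add: coeff_decay_def)
qed

lemma coeff_decay_add:
  assumes "coeff_decay f" "coeff_decay g" shows "coeff_decay (\<lambda>z. f z + g z)"
proof -
  have "taylor_coeff (\<lambda>z. f z + g z) = (\<lambda>n. taylor_coeff f n + taylor_coeff g n)"
    using assms by (intro ext taylor_coeff_add) (auto simp: coeff_decay_def)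
  moreover have "(\<lambda>n. norm (taylor_coeff f n + taylor_coeff g n)) \<in> O(\<lambda>n. 1 / real n powr (3/2))"
    by (rule landau_o.big_trans[OF landau_o.big_mono
          [of _ "\<lambda>n. norm (taylor_coeff f n) + norm (taylor_coeff g n)"] sum_in_bigo(1)])
      (use assms in \<open>auto simp: coeff_decay_def norm_triangle_ineq\<close>)
  ultimately show ?thesis using assms by (auto simp: coeff_decay_def intro!: holomorphic_intros)
qed

lemma coeff_decay_cmult:
  assumes "coeff_decay f" shows "coeff_decay (\<lambda>z. c * f z)"
proof -
  have "taylor_coeff (\<lambda>z. c * f z) = (\<lambda>n. c * taylor_coeff f n)"
    using assms by (intro ext taylor_coeff_cmult) (auto simp: coeff_decay_def)
  thus ?thesis using assms by (auto simp: coeff_decay_def norm_mult intro!: holomorphic_intros)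
qed

lemma coeff_decay_const: "coeff_decay (\<lambda>_. c)"
proof -
  have "eventually (\<lambda>n. taylor_coeff (\<lambda>_. c) n = 0) sequentially"
    using eventually_gt_at_top[of "0::nat"] by eventually_elim (simp add: taylor_coeff_const)
  hence "eventually (\<lambda>n. norm (taylor_coeff (\<lambda>_. c) n) = 0) sequentially"
    by eventually_elim simp
  hence "(\<lambda>n. norm (taylor_coeff (\<lambda>_. c) n)) \<in> O(\<lambda>n. 1 / real n powr (3/2))"
    by (subst landau_o.big.in_cong[of _ "\<lambda>_. 0"]) auto
  thus ?thesis by (simp add: coeff_decay_def)
qed

lemma coeff_decay_mult_z_iff:
  assumes "f holomorphic_on ball 0 1"
  shows "coeff_decay (\<lambda>z. z * f z) \<longleftrightarrow> coeff_decay f"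
proof -
  let ?d = "\<lambda>n. 1 / real n powr (3/2)"
  let ?t = "\<lambda>n. norm (taylor_coeff f n)" and ?u = "\<lambda>n. norm (taylor_coeff (\<lambda>z. z * f z) n)"
  have "?u \<in> O(?d) \<longleftrightarrow> ?t \<in> O(?d)"
  proof
    assume "?u \<in> O(?d)"
    hence "(\<lambda>n. ?u (Suc n)) \<in> O(\<lambda>n. ?d (Suc n))"
      by (rule landau_o.big.compose) (rule filterlim_Suc)
    also have "(\<lambda>n. ?d (Suc n)) \<in> O(?d)" by real_asymp
    finally show "?t \<in> O(?d)" using assms by (simp add: taylor_coeff_shift)
  next
    assume "?t \<in> O(?d)"
    hence "(\<lambda>n. ?t (n - 1)) \<in> O(\<lambda>n. ?d (n - 1))"
      by (rule landau_o.big.compose) (rule filterlim_minus_const_nat_at_top)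
    also have "\<forall>\<^sub>F n in sequentially. ?d (n - 1) = 1 / (real n - 1) powr (3/2)"
      using eventually_gt_at_top[of 0] by eventually_elim (simp add: of_nat_diff)
    hence "O(\<lambda>n. ?d (n - 1)) = O(\<lambda>n. 1 / (real n - 1) powr (3/2))"
      by (rule landau_o.big.cong)
    also have "(\<lambda>n. 1 / (real n - 1) powr (3/2)) \<in> O(?d)" by real_asymp
    finally have "(\<lambda>n. ?t (n - 1)) \<in> O(?d)" .
    moreover have "\<forall>\<^sub>F n in sequentially. ?t (n - 1) = ?u n"
      using eventually_gt_at_top[of 0]
      by eventually_elim (metis Suc_pred' assms taylor_coeff_shift)
    ultimately show "?u \<in> O(?d)"
      by (simp add: landau_o.big.in_cong)
  qed
  moreover have "(\<lambda>z. z * f z) holomorphic_on ball 0 1" using assms by (intro holomorphic_intros)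
  ultimately show ?thesis using assms by (simp add: coeff_decay_def)
qed

text \<open>The coefficients of the second derivative are \<open>(n + 1) * (n + 2)\<close> times those of \<open>f\<close>, so a bound
  on \<open>f''\<close> even gives coefficients of order \<open>1 / n\<^sup>2\<close>.\<close>
lemma coeff_decay_second_deriv:
  assumes f: "\<And>z. z \<in> ball 0 1 \<Longrightarrow> (f has_field_derivative f' z) (at z)"
    and f': "\<And>z. z \<in> ball 0 1 \<Longrightarrow> (f' has_field_derivative f'' z) (at z)"
    and B: "\<And>z. z \<in> ball 0 1 \<Longrightarrow> norm (f'' z) \<le> B"
  shows "coeff_decay f"
proof -
  have hol: "f holomorphic_on ball 0 1" "f' holomorphic_on ball 0 1"
    using f f' unfolding holomorphic_on_def field_differentiable_def
    by (blast intro: has_field_derivative_at_within)+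
  have c1: "taylor_coeff f' n = of_nat (Suc n) * taylor_coeff f (Suc n)" for n
    using taylor_coeff_deriv[OF hol(1), of n] taylor_coeff_cong[of f' "deriv f" n]
    by (auto simp: DERIV_imp_deriv[OF f])
  have c2: "taylor_coeff (deriv f') n = of_nat (Suc n) * taylor_coeff f' (Suc n)" for n
    by (rule taylor_coeff_deriv[OF hol(2)])
  have B0: "norm (taylor_coeff (deriv f') n) \<le> B" for n
    by (rule norm_taylor_coeff_le)
      (use hol B in \<open>auto intro!: holomorphic_deriv simp: DERIV_imp_deriv[OF f']\<close>)
  have bd: "norm (taylor_coeff f (Suc (Suc n))) \<le> B * (1 / (real (n + 1) * real (n + 2)))" for n
  proof -
    have "norm (of_nat (Suc n) * (of_nat (Suc (Suc n)) * taylor_coeff f (Suc (Suc n)))) \<le> B"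
      using B0[of n] unfolding c2 c1 .
    hence "real (n+1) * real (n+2) * norm (taylor_coeff f (Suc (Suc n))) \<le> B"
      unfolding norm_mult norm_of_nat by (simp add: mult.assoc)
    moreover have "real (n+1) * real (n+2) > 0" by simp
    ultimately show ?thesis by (simp only: pos_le_divide_eq mult_1_right times_divide_eq_right mult.commute)
  qed
  have bd': "norm (taylor_coeff f n) \<le> B * (1 / ((real n - 1) * real n))" if n: "n \<ge> 2" for n
  proof -
    obtain k where k: "n = Suc (Suc k)" using n by (metis add_2_eq_Suc le_Suc_ex)
    show ?thesis using bd[of k] by (simp add: k add_ac)
  qed
  have "(\<lambda>n. norm (taylor_coeff f n)) \<in> O(\<lambda>n. 1 / ((real n - 1) * real n))"
  proof (rule bigoI[of _ B])
    show "\<forall>\<^sub>F n in sequentially. norm (norm (taylor_coeff f n)) \<le> B * norm (1 / ((real n - 1) * real n))"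
      using eventually_ge_at_top[of 2]
    proof eventually_elim
      case (elim n)
      have "norm (1 / ((real n - 1) * real n)) = 1 / ((real n - 1) * real n)" using elim by simp
      thus ?case using bd'[OF elim] by simp
    qed
  qed
  also have "(\<lambda>n. 1 / ((real n - 1) * real n)) \<in> O(\<lambda>n. 1 / real n powr (3/2))" by real_asymp
  finally show ?thesis using hol by (simp add: coeff_decay_def)
qed

text \<open>One differentiation in \<open>z\<close> of \<open>(1 - h\<^sup>2)^(k+2) * S(h) / D(h)\<close>, with \<open>h = hit z\<close>, costs two powers
  of \<open>1 - h\<^sup>2\<close>: one by the product rule and one by the pole of the derivative of \<open>hit\<close>. This is the
  numerator that arises over \<open>D\<^sup>2\<close>.\<close>
definition deriv_numerator :: "nat \<Rightarrow> complex poly \<Rightarrow> complex poly \<Rightarrow> complex poly" where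
  "deriv_numerator k S D = smult (1/2) ([:1,0,1:]^2 *
     (smult (-2 * of_nat (k+2)) ([:0,1:] * S * D) + [:1,0,-1:] * (pderiv S * D - S * pderiv D)))"

lemma rational_hit_deriv:
  assumes D: "poly D (hit z) \<noteq> 0" and z: "z \<in> ball 0 1"
  shows "((\<lambda>z. (1 - (hit z)\<^sup>2) ^ (k+2) * (poly S (hit z) / poly D (hit z))) has_field_derivative
           (1 - (hit z)\<^sup>2) ^ k * (poly (deriv_numerator k S D) (hit z) / poly (D * D) (hit z))) (at z)"
proof -
  let ?h = "hit z"
  let ?H = "\<lambda>x. (1 - x\<^sup>2) ^ (k+2) * (poly S x / poly D x)"
  let ?H' = "of_nat (k+2) * (1 - ?h\<^sup>2) ^ (k+1) * (- (2 * ?h)) * (poly S ?h / poly D ?h)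
     + (1 - ?h\<^sup>2) ^ (k+2) * ((poly (pderiv S) ?h * poly D ?h - poly S ?h * poly (pderiv D) ?h)
                               / (poly D ?h * poly D ?h))"
  have "(?H has_field_derivative ?H') (at ?h)"
    by (rule derivative_eq_intros poly_DERIV refl D | simp add: algebra_simps)+
  from DERIV_chain2[OF this deriv_hit[OF z]]
  have "((\<lambda>z. ?H (hit z)) has_field_derivative
      ?H' * ((1 + ?h\<^sup>2)\<^sup>2 / (2 * (1 - ?h\<^sup>2)))) (at z)" .
  moreover have "?H' * ((1 + ?h\<^sup>2)\<^sup>2 / (2 * (1 - ?h\<^sup>2))) =
    (1 - ?h\<^sup>2) ^ k * (poly (deriv_numerator k S D) ?h / poly (D * D) ?h)"
  proof -
    define y where "y = 1 - ?h\<^sup>2"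
    have y: "y \<noteq> 0" unfolding y_def using hit_neq_pm1(2)[OF z] .
    define a where "a = poly S ?h" define b where "b = poly D ?h"
    define a' where "a' = poly (pderiv S) ?h" define b' where "b' = poly (pderiv D) ?h"
    define c where "c = (1 + ?h\<^sup>2)\<^sup>2"
    define m where "m = (of_nat (k+2) :: complex)"
    have b: "b \<noteq> 0" using D b_def by simp
    have S': "poly (deriv_numerator k S D) ?h = c / 2 * (- 2 * m * (?h * a * b) + y * (a' * b - a * b'))"
    proof -
      have "poly ([:1,0,1:]^2) ?h = c" "poly [:1,0,-1:] ?h = y" "poly [:0,1:] ?h = ?h"
        by (simp_all add: c_def y_def power2_eq_square algebra_simps)
      thus ?thesis
        unfolding deriv_numerator_def poly_smult poly_mult poly_add poly_diff m_def[symmetric]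
          a_def[symmetric] b_def[symmetric] a'_def[symmetric] b'_def[symmetric] by simp
    qed
    have "(m * (y * y ^ k) * (- 2 * ?h) * (a / b) + (y * (y * y ^ k)) * ((a' * b - a * b') / (b * b))) * (c / (2 * y))
       = y ^ k * (c / 2 * (- 2 * m * (?h * a * b) + y * (a' * b - a * b')) / (b * b))"
      using y b by (simp add: divide_simps) (simp add: algebra_simps)
    thus ?thesis unfolding S' poly_mult
      unfolding a_def[symmetric] b_def[symmetric] a'_def[symmetric] b'_def[symmetric]
         c_def[symmetric] m_def[symmetric] y_def[symmetric] by simp
  qed
  ultimately show ?thesis by simp
qed

lemma rational_hit_bounded:
  assumes D: "\<And>z. z \<in> cball 0 1 \<Longrightarrow> poly D (hit z) \<noteq> 0"
  obtains B where "\<And>z. z \<in> ball 0 1 \<Longrightarrow> norm (poly S (hit z) / poly D (hit z)) \<le> B"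
proof -
  have "continuous_on (cball 0 1) (\<lambda>z. poly S (hit z) / poly D (hit z))"
    by (intro continuous_intros continuous_on_hit) (use D in auto)
  hence "compact ((\<lambda>z. poly S (hit z) / poly D (hit z)) ` cball 0 1)"
    by (intro compact_continuous_image) auto
  then obtain B where B: "\<forall>x\<in>(\<lambda>z. poly S (hit z) / poly D (hit z)) ` cball 0 1. norm x \<le> B"
    using compact_imp_bounded bounded_iff by blast
  show ?thesis by (rule that[of B]) (use B in auto)
qed

text \<open>Two differentiations use up the fourth power of \<open>1 - h\<^sup>2\<close> exactly and leave a function that is
  continuous on the closed disc.\<close>
lemma coeff_decay_vanishing_rational:
  assumes D: "\<And>z. z \<in> cball 0 1 \<Longrightarrow> poly D (hit z) \<noteq> 0"
  shows "coeff_decay (\<lambda>z. (1 - (hit z)\<^sup>2) ^ 4 * (poly S (hit z) / poly D (hit z)))"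
proof -
  have D1: "\<And>z. z \<in> ball 0 1 \<Longrightarrow> poly D (hit z) \<noteq> 0" using D by simp
  define S1 where "S1 = deriv_numerator 2 S D"
  define S2 where "S2 = deriv_numerator 0 S1 (D * D)"
  have 1: "((\<lambda>z. (1 - (hit z)\<^sup>2) ^ 4 * (poly S (hit z) / poly D (hit z))) has_field_derivative
           (1 - (hit z)\<^sup>2) ^ 2 * (poly S1 (hit z) / poly (D * D) (hit z))) (at z)"
    if "z \<in> ball 0 1" for z
    using rational_hit_deriv[OF D1[OF that] that, of 2 S] unfolding S1_def by simp
  have 2: "((\<lambda>z. (1 - (hit z)\<^sup>2) ^ 2 * (poly S1 (hit z) / poly (D * D) (hit z))) has_field_derivative
           (1 - (hit z)\<^sup>2) ^ 0 * (poly S2 (hit z) / poly (D * D * (D * D)) (hit z))) (at z)"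
    if "z \<in> ball 0 1" for z
  proof -
    have "poly (D * D) (hit z) \<noteq> 0" using D1[OF that] by simp
    from rational_hit_deriv[OF this that, of 0 S1] show ?thesis unfolding S2_def by (simp add: numeral_2_eq_2)
  qed
  obtain B where B: "\<And>z. z \<in> ball 0 1 \<Longrightarrow> norm (poly S2 (hit z) / poly (D*D*(D*D)) (hit z)) \<le> B"
    using rational_hit_bounded[of "D*D*(D*D)" S2] D by auto
  show ?thesis
    by (rule coeff_decay_second_deriv[OF 1 2]) (use B in auto)
qed

section \<open>Return probabilities and Wallis' product\<close>

text \<open>The probability \<open>(2*m choose m) / 4^m\<close>, given by the recursion that the coefficients of \<open>tau\<close>
  satisfy.\<close>
primrec return_prob :: "nat \<Rightarrow> real" where
  "return_prob 0 = 1"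
| "return_prob (Suc m) = return_prob m * (real (2 * m + 1) / real (2 * m + 2))"

lemma return_prob_pos: "return_prob m > 0"
  by (induction m) auto

lemma return_prob_wallis:
  "(return_prob m)\<^sup>2 * real (2 * m + 1) = inverse (\<Prod>k=1..m. (4*real k^2) / (4*real k^2 - 1))"
proof (induction m)
  case (Suc m)
  define x where "x = real m"
  have x: "x \<ge> 0" by (simp add: x_def)
  have "(return_prob (Suc m))\<^sup>2 * real (2 * Suc m + 1)
     = ((return_prob m)\<^sup>2 * real (2 * m + 1)) * ((2 * x + 1) * (2 * x + 3) / (2 * x + 2)\<^sup>2)"
    by (simp add: power_mult_distrib power_divide power2_eq_square x_def add_ac)
  also have "(2 * x + 1) * (2 * x + 3) / (2 * x + 2)\<^sup>2 = inverse ((4*real (Suc m)^2) / (4*real (Suc m)^2 - 1))"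
    by (simp add: x_def power2_eq_square algebra_simps)
  finally have "(return_prob (Suc m))\<^sup>2 * real (2 * Suc m + 1)
    = inverse (\<Prod>k=1..m. (4*real k^2) / (4*real k^2 - 1)) * inverse ((4*real (Suc m)^2) / (4*real (Suc m)^2 - 1))"
    unfolding Suc .
  also have "\<dots> = inverse (\<Prod>k=1..Suc m. (4*real k^2) / (4*real k^2 - 1))"
    unfolding inverse_mult_distrib[symmetric] by (subst prod.nat_ivl_Suc') (simp_all add: mult.commute)
  finally show ?case .
qed simp

text \<open>The shift \<open>1/4\<close> makes the quotient of consecutive terms \<open>1 + O(1 / m^3)\<close>, so that the limit is
  approached with an error of order \<open>1 / m\<^sup>2\<close>. With any other shift the error would be of order \<open>1 / m\<close>,
  too large for the second term in the expansion of \<^const>\<open>return_prob\<close>.\<close>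
definition wallis_ratio :: "nat \<Rightarrow> real" where
  "wallis_ratio m = pi * (return_prob m)\<^sup>2 * (real m + 1/4)"

lemma wallis_ratio_tendsto: "wallis_ratio \<longlonglongrightarrow> 1"
proof -
  have "(\<lambda>m. (return_prob m)\<^sup>2 * real (2 * m + 1)) \<longlonglongrightarrow> inverse (pi / 2)"
    unfolding return_prob_wallis by (intro tendsto_inverse wallis) simp
  moreover have "(\<lambda>m. pi * ((real m + 1/4) / real (2 * m + 1))) \<longlonglongrightarrow> pi / 2"
    by real_asymp
  ultimately have "(\<lambda>m. (return_prob m)\<^sup>2 * real (2 * m + 1) *
       (pi * ((real m + 1/4) / real (2 * m + 1)))) \<longlonglongrightarrow> inverse (pi / 2) * (pi / 2)"
    by (rule tendsto_mult)
  moreover have "(return_prob m)\<^sup>2 * real (2 * m + 1) * (pi * ((real m + 1/4) / real (2 * m + 1))) = wallis_ratio m" for m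
    unfolding wallis_ratio_def by (simp del: of_nat_mult of_nat_add)
  ultimately show ?thesis by simp
qed

lemma wallis_ratio_Suc:
  "wallis_ratio (Suc m) = wallis_ratio m *
     (1 + 1 / (16 * real m ^ 3 + 36 * real m ^ 2 + 24 * real m + 4))"
proof -
  define x where "x = real m"
  have x: "x \<ge> 0" by (simp add: x_def)
  have d: "16 * x ^ 3 + 36 * x ^ 2 + 24 * x + 4 = (2 * x + 2)\<^sup>2 * (4 * x + 1)"
    by (simp add: power2_eq_square power3_eq_cube algebra_simps)
  have "((2 * x + 1) / (2 * x + 2))\<^sup>2 * (x + 1 + 1/4) = (x + 1/4) * (1 + 1 / ((2 * x + 2)\<^sup>2 * (4 * x + 1)))"
    using x by (simp add: divide_simps) (simp add: power2_eq_square algebra_simps)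
  hence "pi * (return_prob m)\<^sup>2 * (((2 * x + 1) / (2 * x + 2))\<^sup>2 * (x + 1 + 1/4))
       = pi * (return_prob m)\<^sup>2 * ((x + 1/4) * (1 + 1 / ((2 * x + 2)\<^sup>2 * (4 * x + 1))))" by simp
  moreover have "(return_prob (Suc m))\<^sup>2 = (return_prob m)\<^sup>2 * ((2 * x + 1) / (2 * x + 2))\<^sup>2"
    by (simp add: x_def power_mult_distrib[symmetric] add_ac)
  moreover have "real (Suc m) + 1/4 = x + 1 + 1/4" by (simp add: x_def)
  ultimately show ?thesis unfolding wallis_ratio_def x_def[symmetric] d by (simp only: mult.assoc)
qed

lemma wallis_ratio_pos: "wallis_ratio m > 0"
  unfolding wallis_ratio_def using return_prob_pos[of m] by simp

lemma wallis_ratio_le_1: "wallis_ratio m \<le> 1"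
proof (rule incseq_le[OF _ wallis_ratio_tendsto])
  show "incseq wallis_ratio"
    by (rule incseq_SucI) (use wallis_ratio_pos in \<open>simp add: wallis_ratio_Suc algebra_simps less_imp_le\<close>)
qed

text \<open>The product with \<open>1 + 1 / m\<^sup>2\<close> decreases to the common limit 1, so that \<^const>\<open>wallis_ratio\<close> is
  enclosed between \<open>1 / (1 + 1 / m\<^sup>2)\<close> and 1.\<close>
lemma wallis_ratio_ge:
  assumes "m \<ge> 1"
  shows "wallis_ratio m * (1 + 1 / (real m)\<^sup>2) \<ge> 1"
proof -
  let ?u = "\<lambda>k. wallis_ratio (Suc k) * (1 + 1 / (real (Suc k))\<^sup>2)"
  \<comment> \<open>The increment \<open>1 / x\<^sup>2 - 1 / (x + 1)\<^sup>2\<close> is about \<open>2 / x^3\<close> and outweighs the growth of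
     \<open>wallis_ratio\<close>, about \<open>1 / (16 * x^3)\<close>.\<close>
  have step: "(1 + 1 / (16 * x ^ 3 + 36 * x ^ 2 + 24 * x + 4)) * (1 + 1 / (x + 1)\<^sup>2) \<le> 1 + 1 / x\<^sup>2"
    if x: "x \<ge> 1" for x :: real
  proof -
    have "1 / (x+1)\<^sup>2 \<le> 1" using x by simp
    hence "(1 + 1 / (16 * x ^ 3 + 36 * x ^ 2 + 24 * x + 4)) * (1 + 1 / (x + 1)\<^sup>2)
      \<le> 1 + 1 / (x + 1)\<^sup>2 + 1 / (16 * x ^ 3 + 36 * x ^ 2 + 24 * x + 4) * 2"
      using x by (simp add: algebra_simps divide_right_mono)
    also have "1 / (16 * x ^ 3 + 36 * x ^ 2 + 24 * x + 4) * 2 \<le> 1 / x\<^sup>2 - 1 / (x+1)\<^sup>2"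
    proof -
      have "1 / x\<^sup>2 - 1 / (x+1)\<^sup>2 = (2 * x + 1) / (x\<^sup>2 * (x+1)\<^sup>2)"
        using x by (simp add: divide_simps) (simp add: power2_eq_square algebra_simps)
      moreover have "2 / (16 * x ^ 3 + 36 * x ^ 2 + 24 * x + 4) \<le> (2 * x + 1) / (x\<^sup>2 * (x+1)\<^sup>2)"
      proof -
        have d: "16 * x ^ 3 + 36 * x ^ 2 + 24 * x + 4 = 4 * (x + 1)\<^sup>2 * (4 * x + 1)"
          by (simp add: power2_eq_square power3_eq_cube algebra_simps)
        have "x\<^sup>2 \<le> (2 * x + 1) * (2 * (4 * x + 1))"
          using x by (simp add: power2_eq_square algebra_simps)
        hence "1 / (2 * (4 * x + 1)) \<le> (2 * x + 1) / x\<^sup>2" using x by (simp add: field_simps)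
        hence le: "1 / (2 * (4 * x + 1)) / (x+1)\<^sup>2 \<le> (2 * x + 1) / x\<^sup>2 / (x+1)\<^sup>2"
          by (rule divide_right_mono) simp
        have "2 / (4 * (x + 1)\<^sup>2 * (4 * x + 1)) = 1 / (2 * (4 * x + 1)) / (x+1)\<^sup>2"
          using x by (simp add: divide_simps)
        also note le
        also have "(2 * x + 1) / x\<^sup>2 / (x+1)\<^sup>2 = (2 * x + 1) / (x\<^sup>2 * (x+1)\<^sup>2)" by simp
        finally show ?thesis unfolding d .
      qed
      ultimately show ?thesis by simp
    qed
    finally show ?thesis by simp
  qed
  have "decseq ?u"
  proof (rule decseq_SucI)
    fix k
    have "?u (Suc k) = wallis_ratio (Suc k) *
        ((1 + 1 / (16 * real (Suc k) ^ 3 + 36 * real (Suc k) ^ 2 + 24 * real (Suc k) + 4))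
          * (1 + 1 / (real (Suc k) + 1)\<^sup>2))"
      by (subst wallis_ratio_Suc[of "Suc k"]) (simp add: mult.assoc add_ac)
    also have "\<dots> \<le> ?u k"
      by (intro mult_left_mono step less_imp_le[OF wallis_ratio_pos]) simp
    finally show "?u (Suc k) \<le> ?u k" .
  qed
  moreover have "?u \<longlonglongrightarrow> 1 * (1 + 0)"
  proof (intro tendsto_mult tendsto_add tendsto_const)
    show "(\<lambda>k. wallis_ratio (Suc k)) \<longlonglongrightarrow> 1" using wallis_ratio_tendsto by (rule LIMSEQ_Suc)
    show "(\<lambda>k. 1 / (real (Suc k))\<^sup>2) \<longlonglongrightarrow> 0" by real_asymp
  qed
  ultimately have "?u k \<ge> 1" for k using decseq_ge[of ?u "1 * (1 + 0)" k] by simp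
  from this[of "m - 1"] show ?thesis using assms by simp
qed

lemma return_prob_asymp:
  "(\<lambda>m. return_prob m - 1 / sqrt (pi * (real m + 1/4))) \<in> O(\<lambda>m. 1 / real m powr (5/2))"
proof -
  have "(\<lambda>m. return_prob m - 1 / sqrt (pi * (real m + 1/4)))
      \<in> O(\<lambda>m. 1 / sqrt (pi * (real m + 1/4)) * (1 / (real m)\<^sup>2))"
  proof (rule bigoI[of _ 1])
    show "\<forall>\<^sub>F m in sequentially. norm (return_prob m - 1 / sqrt (pi * (real m + 1/4)))
        \<le> 1 * norm (1 / sqrt (pi * (real m + 1/4)) * (1 / (real m)\<^sup>2))"
      using eventually_ge_at_top[of 1]
    proof eventually_elim
      case (elim m)
      let ?q = "wallis_ratio m" and ?s = "sqrt (pi * (real m + 1/4))"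
      have s: "?s > 0" by (simp add: add_pos_pos add_nonneg_pos)
      have q: "0 < ?q" "?q \<le> 1" by (rule wallis_ratio_pos wallis_ratio_le_1)+
      have "(return_prob m * ?s)\<^sup>2 = ?q"
        by (simp add: power_mult_distrib wallis_ratio_def)
      hence rs: "return_prob m * ?s = sqrt ?q"
        using return_prob_pos[of m] s by (metis less_imp_le mult_pos_pos real_sqrt_unique)
      \<comment> \<open>\<open>1 - sqrt q \<le> 1 - q\<close> on the unit interval reduces the claim to the enclosure of \<open>q\<close>.\<close>
      have "sqrt ?q \<le> 1" using q by simp
      moreover have "?q \<le> sqrt ?q" using q
        by (metis \<open>sqrt ?q \<le> 1\<close> less_imp_le mult_left_le real_sqrt_ge_zero real_sqrt_mult_self abs_of_pos)
      moreover have "?q + ?q * (1 / (real m)\<^sup>2) \<ge> 1" using wallis_ratio_ge[OF elim] by (simp add: algebra_simps)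
      moreover have "?q * (1 / (real m)\<^sup>2) \<le> 1 * (1 / (real m)\<^sup>2)" by (rule mult_right_mono) (use q in auto)
      ultimately have "\<bar>sqrt ?q - 1\<bar> \<le> 1 / (real m)\<^sup>2" by linarith
      moreover have "return_prob m - 1 / ?s = (sqrt ?q - 1) / ?s"
        unfolding rs[symmetric] diff_divide_distrib using s by simp
      ultimately have "\<bar>return_prob m - 1 / ?s\<bar> \<le> 1 / (real m)\<^sup>2 / ?s"
        using s by (simp only: abs_divide abs_of_pos divide_right_mono less_imp_le)
      moreover have "norm (1 / ?s * (1 / (real m)\<^sup>2)) = 1 / (real m)\<^sup>2 / ?s" using s by simp
      ultimately show ?case unfolding real_norm_def by linarith
    qed
  qed
  also have "(\<lambda>m. 1 / sqrt (pi * (real m + 1/4)) * (1 / (real m)\<^sup>2)) \<in> O(\<lambda>m. 1 / real m powr (5/2))"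
    by real_asymp
  finally show ?thesis .
qed

section \<open>The coefficients of \<open>tau\<close> and \<open>tau^3\<close>\<close>

definition tau_coeff :: "nat \<Rightarrow> real" where
  "tau_coeff n = return_prob (n div 2)"

text \<open>Since \<open>tau\<^sup>2 = (1 + z) / (1 - z)\<close>, the \<open>n\<close>-th coefficient of \<open>tau^3\<close> is the sum of the coefficients
  \<open>k\<close> and \<open>k - 1\<close> of \<open>tau\<close> over \<open>k \<le> n\<close>. The factors \<open>8*m + 1\<close> (for \<open>n = 2*m\<close>) and \<open>8*m + 3\<close> (for \<open>n = 2*m + 1\<close>) that arise are written in terms of \<open>n\<close>.\<close>
definition tau_cube_coeff :: "nat \<Rightarrow> real" where
  "tau_cube_coeff n = (if even n then 4 * real n + 1 else 4 * real n - 1) * return_prob (n div 2)"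

lemma taylor_coeff_tau_rec:
  "of_nat (Suc n) * taylor_coeff tau (Suc n) =
     taylor_coeff tau n + (of_nat n - 1) * (if n = 0 then 0 else taylor_coeff tau (n - 1))"
proof -
  have hd: "deriv tau holomorphic_on ball 0 1"
    by (intro holomorphic_deriv holomorphic_tau) auto
  have "of_nat (Suc n) * taylor_coeff tau (Suc n) = taylor_coeff (deriv tau) n"
    by (rule taylor_coeff_deriv[OF holomorphic_tau, symmetric])
  also have "\<dots> = taylor_coeff (\<lambda>z. tau z + z * (z * deriv tau z)) n"
    by (rule taylor_coeff_cong) (rule deriv_tau)
  also have "\<dots> = taylor_coeff tau n + taylor_coeff (\<lambda>z. z * (z * deriv tau z)) n"
    by (intro taylor_coeff_add holomorphic_intros hd)
  also have "taylor_coeff (\<lambda>z. z * (z * deriv tau z)) n =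
      (of_nat n - 1) * (if n = 0 then 0 else taylor_coeff tau (n - 1))"
  proof (cases n)
    case 0
    thus ?thesis by (simp add: taylor_coeff_0)
  next
    case (Suc m)
    have "taylor_coeff (\<lambda>z. z * (z * deriv tau z)) n = taylor_coeff (\<lambda>z. z * deriv tau z) m"
      unfolding Suc by (intro taylor_coeff_shift holomorphic_intros hd)
    also have "\<dots> = of_nat m * taylor_coeff tau m"
    proof (cases m)
      case (Suc k)
      show ?thesis unfolding Suc
        by (subst taylor_coeff_shift[OF hd]) (rule taylor_coeff_deriv[OF holomorphic_tau])
    qed (simp add: taylor_coeff_0)
    finally show ?thesis using Suc by simp
  qed
  finally show ?thesis .
qed

lemma tau_0: "tau 0 = 1"
  by (simp add: tau_def disc_root_def)

lemma taylor_coeff_tau: "taylor_coeff tau n = of_real (tau_coeff n)"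
proof -
  have "taylor_coeff tau (2 * m) = of_real (return_prob m) \<and>
        taylor_coeff tau (2 * m + 1) = of_real (return_prob m)" for m
  proof (induction m)
    case 0
    show ?case using taylor_coeff_tau_rec[of 0] by (simp add: taylor_coeff_0 tau_0)
  next
    case (Suc m)
    have "real (2 * m + 2) * return_prob (Suc m) = real (2 * m + 1) * return_prob m" by simp
    hence rp: "of_nat (2 * m + 2) * of_real (return_prob (Suc m)) =
        (of_nat (2 * m + 1) :: complex) * of_real (return_prob m)"
      by (metis of_real_mult of_real_of_nat_eq)
    have "of_nat (2 * m + 2) * taylor_coeff tau (2 * m + 2) =
        (of_nat (2 * m + 1) :: complex) * of_real (return_prob m)"
      using taylor_coeff_tau_rec[of "2 * m + 1"] Suc by (simp add: algebra_simps)
    hence 1: "taylor_coeff tau (2 * m + 2) = of_real (return_prob (Suc m))"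
      unfolding rp[symmetric] mult_cancel_left of_nat_eq_0_iff by simp
    have "of_nat (2 * m + 3) * taylor_coeff tau (2 * m + 3) =
        taylor_coeff tau (2 * m + 2) + (of_nat (2 * m + 1) :: complex) * taylor_coeff tau (2 * m + 1)"
      using taylor_coeff_tau_rec[of "2 * m + 2"] by (simp add: eval_nat_numeral)
    also have "(of_nat (2 * m + 1) :: complex) * taylor_coeff tau (2 * m + 1)
        = of_nat (2 * m + 2) * of_real (return_prob (Suc m))"
      using Suc rp by simp
    finally have "of_nat (2 * m + 3) * taylor_coeff tau (2 * m + 3) =
        (of_nat (2 * m + 3) :: complex) * of_real (return_prob (Suc m))"
      unfolding 1 by (simp add: algebra_simps del: return_prob.simps)
    hence "taylor_coeff tau (2 * m + 3) = of_real (return_prob (Suc m))"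
      by (simp del: of_nat_add of_nat_mult of_nat_Suc return_prob.simps)
    thus ?case using 1 by (simp add: eval_nat_numeral del: return_prob.simps)
  qed
  thus ?thesis unfolding tau_coeff_def by (cases "even n") (auto elim!: evenE oddE)
qed

lemma taylor_coeff_tau_cube: "taylor_coeff (\<lambda>z. tau z ^ 3) n = of_real (tau_cube_coeff n)"
proof (induction n)
  case 0
  show ?case by (simp add: taylor_coeff_0 tau_0 tau_cube_coeff_def)
next
  case (Suc n)
  have eq: "tau z ^ 3 = z * (tau z ^ 3) + (tau z + z * tau z)" if "z \<in> ball 0 1" for z
    using tau_sq[OF that] by algebra
  have "taylor_coeff (\<lambda>z. tau z ^ 3) (Suc n) = taylor_coeff (\<lambda>z. z * (tau z ^ 3) + (tau z + z * tau z)) (Suc n)"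
    by (rule taylor_coeff_cong) (rule eq)
  also have "\<dots> = taylor_coeff (\<lambda>z. z * (tau z ^ 3)) (Suc n) + (taylor_coeff tau (Suc n) + taylor_coeff (\<lambda>z. z * tau z) (Suc n))"
    by (simp add: taylor_coeff_add holomorphic_intros)
  also have "\<dots> = taylor_coeff (\<lambda>z. tau z ^ 3) n + (taylor_coeff tau (Suc n) + taylor_coeff tau n)"
    by (simp add: taylor_coeff_shift holomorphic_intros)
  also have "\<dots> = of_real (tau_cube_coeff n + (tau_coeff (Suc n) + tau_coeff n))"
    unfolding Suc taylor_coeff_tau by simp
  also have "tau_cube_coeff n + (tau_coeff (Suc n) + tau_coeff n) = tau_cube_coeff (Suc n)"
  proof (cases "even n")
    case True
    then obtain m where m: "n = 2 * m" by (elim evenE)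
    show ?thesis by (simp add: m tau_cube_coeff_def tau_coeff_def algebra_simps)
  next
    case False
    then obtain m where m: "n = 2 * m + 1" by (elim oddE)
    show ?thesis by (simp add: m tau_cube_coeff_def tau_coeff_def field_simps)
  qed
  finally show ?case .
qed

text \<open>Needed because the coefficients of \<open>tau\<close> and \<open>tau^3\<close> have different closed forms at even and odd indices.\<close>
lemma bigo_from_parity:
  fixes f :: "nat \<Rightarrow> real"
  assumes e: "(\<lambda>m. f (2 * m)) \<in> O(\<lambda>m. 1 / real m powr a)"
    and o: "(\<lambda>m. f (2 * m + 1)) \<in> O(\<lambda>m. 1 / real m powr a)" and a: "a \<ge> 0"
  shows "f \<in> O(\<lambda>n. 1 / real n powr a)"
proof -
  let ?h = "\<lambda>n::nat. n div 2"
  have half: "filterlim ?h at_top at_top"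
    unfolding filterlim_at_top
  proof
    fix Z :: nat
    show "eventually (\<lambda>n. Z \<le> n div 2) sequentially"
      by (rule eventually_at_top_linorderI[of "2 * Z"]) linarith
  qed
  have 1: "(\<lambda>n. f (2 * ?h n)) \<in> O(\<lambda>n. 1 / real (?h n) powr a)"
    by (rule landau_o.big.compose[OF e half])
  have 2: "(\<lambda>n. f (2 * ?h n + 1)) \<in> O(\<lambda>n. 1 / real (?h n) powr a)"
    by (rule landau_o.big.compose[OF o half])
  have "(\<lambda>n. \<bar>f (2 * ?h n)\<bar> + \<bar>f (2 * ?h n + 1)\<bar>) \<in> O(\<lambda>n. 1 / real (?h n) powr a)"
    using 1 2 by (intro sum_in_bigo) simp_all
  moreover have "f \<in> O(\<lambda>n. \<bar>f (2 * ?h n)\<bar> + \<bar>f (2 * ?h n + 1)\<bar>)"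
  proof (rule landau_o.big_mono, rule always_eventually, rule allI)
    fix n show "norm (f n) \<le> norm (\<bar>f (2 * ?h n)\<bar> + \<bar>f (2 * ?h n + 1)\<bar>)"
      by (cases "even n") (auto elim!: evenE oddE)
  qed
  moreover have "(\<lambda>n. 1 / real (?h n) powr a) \<in> O(\<lambda>n. 1 / real n powr a)"
  proof (rule bigoI[of _ "3 powr a"])
    show "\<forall>\<^sub>F n in sequentially. norm (1 / real (?h n) powr a) \<le> 3 powr a * norm (1 / real n powr a)"
      using eventually_ge_at_top[of 2]
    proof eventually_elim
      case (elim n)
      have "n \<le> 3 * (n div 2)" using elim by presburger
      hence "real n \<le> 3 * real (?h n)" by linarith
      hence "real n powr a \<le> (3 * real (?h n)) powr a" using a by (intro powr_mono2) auto
      also have "\<dots> = 3 powr a * real (?h n) powr a" by (simp add: powr_mult)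
      finally have "real n powr a \<le> 3 powr a * real (?h n) powr a" .
      moreover have "?h n > 0" using elim by simp
      ultimately show ?case using elim by (simp add: field_simps)
    qed
  qed
  ultimately show ?thesis using landau_o.big_trans by blast
qed

lemma tau_coeff_asymp:
  "(\<lambda>n. tau_coeff n - sqrt (2 / pi) / sqrt (real n)) \<in> O(\<lambda>n. 1 / real n powr (3/2))" (is "?f \<in> _")
proof (rule bigo_from_parity)
  let ?e = "\<lambda>m. return_prob m - 1 / sqrt (pi * (real m + 1/4))"
  have e: "?e \<in> O(\<lambda>m. 1 / real m powr (3/2))"
  proof -
    have "(\<lambda>m. 1 / real m powr (5/2)) \<in> O(\<lambda>m. 1 / real m powr (3/2))" by real_asymp
    thus ?thesis using return_prob_asymp landau_o.big_trans by blast
  qed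
  have scale: "sqrt (2 / pi) / sqrt x = 1 / sqrt pi * (1 / sqrt (x / 2))" for x
    by (simp add: real_sqrt_divide)
  have split: "1 / sqrt (pi * x) = 1 / sqrt pi * (1 / sqrt x)" for x
    by (simp add: real_sqrt_mult)
  have "(\<lambda>m. 1 / sqrt (real m + 1/4) - 1 / sqrt (2 * real m / 2)) \<in> O(\<lambda>m. 1 / real m powr (3/2))"
    by real_asymp
  hence "(\<lambda>m. 1 / sqrt pi * (1 / sqrt (real m + 1/4) - 1 / sqrt (2 * real m / 2))) \<in> O(\<lambda>m. 1 / real m powr (3/2))"
    by simp
  hence "(\<lambda>m. 1 / sqrt (pi * (real m + 1/4)) - sqrt (2 / pi) / sqrt (2 * real m)) \<in> O(\<lambda>m. 1 / real m powr (3/2))"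
    unfolding scale split right_diff_distrib .
  from sum_in_bigo(1)[OF e this] show "(\<lambda>m. ?f (2 * m)) \<in> O(\<lambda>m. 1 / real m powr (3/2))"
    by (simp add: tau_coeff_def)
  have "(\<lambda>m. 1 / sqrt (real m + 1/4) - 1 / sqrt ((2 * real m + 1) / 2)) \<in> O(\<lambda>m. 1 / real m powr (3/2))"
    by real_asymp
  hence "(\<lambda>m. 1 / sqrt pi * (1 / sqrt (real m + 1/4) - 1 / sqrt ((2 * real m + 1) / 2))) \<in> O(\<lambda>m. 1 / real m powr (3/2))"
    by simp
  hence "(\<lambda>m. 1 / sqrt (pi * (real m + 1/4)) - sqrt (2 / pi) / sqrt (2 * real m + 1)) \<in> O(\<lambda>m. 1 / real m powr (3/2))"
    unfolding scale split right_diff_distrib .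
  from sum_in_bigo(1)[OF e this] show "(\<lambda>m. ?f (2 * m + 1)) \<in> O(\<lambda>m. 1 / real m powr (3/2))"
    by (simp add: tau_coeff_def add_ac)
qed simp

text \<open>No term of order \<open>1 / sqrt n\<close> occurs, for either parity: in
  \<open>(8*m + 1) / sqrt (m + 1/4)\<close> and \<open>(8*m + 3) / sqrt (m + 1/4)\<close>, expressed by \<open>n\<close>, the contributions
  of numerator and denominator cancel.\<close>
lemma tau_cube_coeff_asymp:
  "(\<lambda>n. tau_cube_coeff n - 4 * sqrt (2 / pi) * sqrt (real n)) \<in> O(\<lambda>n. 1 / real n powr (3/2))" (is "?f \<in> _")
proof (rule bigo_from_parity)
  let ?e = "\<lambda>m. return_prob m - 1 / sqrt (pi * (real m + 1/4))"
  have e: "(\<lambda>m. (8 * real m + c) * ?e m) \<in> O(\<lambda>m. 1 / real m powr (3/2))" for c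
  proof -
    have "(\<lambda>m. (8 * real m + c) * ?e m) \<in> O(\<lambda>m. (8 * real m + c) * (1 / real m powr (5/2)))"
      by (intro landau_o.big.mult return_prob_asymp) simp
    also have "(\<lambda>m. (8 * real m + c) * (1 / real m powr (5/2))) \<in> O(\<lambda>m. 1 / real m powr (3/2))" by real_asymp
    finally show ?thesis .
  qed
  have scale: "4 * sqrt (2 / pi) * sqrt x = 1 / sqrt pi * (8 * sqrt (x / 2))" for x
    by (simp add: real_sqrt_divide field_simps)
  have split: "c * (1 / sqrt (pi * x)) = 1 / sqrt pi * (c / sqrt x)" for c x
    by (simp add: real_sqrt_mult)
  have "(\<lambda>m. (8 * real m + 1) / sqrt (real m + 1/4) - 8 * sqrt (2 * real m / 2)) \<in> O(\<lambda>m. 1 / real m powr (3/2))"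
    by real_asymp
  hence "(\<lambda>m. 1 / sqrt pi * ((8 * real m + 1) / sqrt (real m + 1/4) - 8 * sqrt (2 * real m / 2))) \<in> O(\<lambda>m. 1 / real m powr (3/2))"
    by simp
  hence "(\<lambda>m. (8 * real m + 1) * (1 / sqrt (pi * (real m + 1/4))) - 4 * sqrt (2 / pi) * sqrt (2 * real m)) \<in> O(\<lambda>m. 1 / real m powr (3/2))"
    unfolding scale split right_diff_distrib .
  from sum_in_bigo(1)[OF e[of 1] this] show "(\<lambda>m. ?f (2 * m)) \<in> O(\<lambda>m. 1 / real m powr (3/2))"
    by (simp add: tau_cube_coeff_def algebra_simps)
  have "(\<lambda>m. (8 * real m + 3) / sqrt (real m + 1/4) - 8 * sqrt ((2 * real m + 1) / 2)) \<in> O(\<lambda>m. 1 / real m powr (3/2))"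
    by real_asymp
  hence "(\<lambda>m. 1 / sqrt pi * ((8 * real m + 3) / sqrt (real m + 1/4) - 8 * sqrt ((2 * real m + 1) / 2))) \<in> O(\<lambda>m. 1 / real m powr (3/2))"
    by simp
  hence "(\<lambda>m. (8 * real m + 3) * (1 / sqrt (pi * (real m + 1/4))) - 4 * sqrt (2 / pi) * sqrt (2 * real m + 1)) \<in> O(\<lambda>m. 1 / real m powr (3/2))"
    unfolding scale split right_diff_distrib .
  from sum_in_bigo(1)[OF e[of 3] this] show "(\<lambda>m. ?f (2 * m + 1)) \<in> O(\<lambda>m. 1 / real m powr (3/2))"
    by (simp add: tau_cube_coeff_def algebra_simps)
qed simp

section \<open>Rational functions of the passage time generating function\<close>

text \<open>Both sides are \<open>1 - sqrt (1 - z\<^sup>2)\<close>; so the coefficients of \<open>hit\<close> are differences of consecutive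
  coefficients of \<open>tau\<close>, which gains a factor \<open>1 / n\<close>.\<close>
lemma z_mult_hit_eq_tau: "z \<in> ball 0 1 \<Longrightarrow> z * hit z = 1 + ((-1) * tau z + z * tau z)"
proof -
  assume z: "z \<in> ball 0 1"
  have t: "tau z * disc_root z = 1 + z" using disc_root_nonzero[OF z] by (simp add: tau_def)
  have h: "hit z * (1 + disc_root z) = z"
    using one_plus_disc_root_nonzero[of z] by (simp add: hit_def)
  have "disc_root z * (disc_root z - (1 - z) * tau z) = 0"
    using t disc_root_sq[of z] by algebra
  hence d: "(1 - z) * tau z = disc_root z" using disc_root_nonzero[OF z] by simp
  have "(1 + disc_root z) * (z * hit z - (1 - disc_root z)) = z * (hit z * (1 + disc_root z)) - (1 - (disc_root z)\<^sup>2)"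
    by (simp add: algebra_simps power2_eq_square)
  also have "\<dots> = 0" unfolding h disc_root_sq by (simp add: power2_eq_square)
  finally have "z * hit z = 1 - disc_root z" using one_plus_disc_root_nonzero[of z] by simp
  thus ?thesis unfolding d[symmetric] by (simp add: algebra_simps)
qed

lemma taylor_coeff_hit: "taylor_coeff hit n = of_real (tau_coeff n - tau_coeff (Suc n))"
proof -
  have "taylor_coeff hit n = taylor_coeff (\<lambda>z. z * hit z) (Suc n)"
    by (rule taylor_coeff_shift[OF holomorphic_hit, symmetric])
  also have "\<dots> = taylor_coeff (\<lambda>z. 1 + ((-1) * tau z + z * tau z)) (Suc n)"
    by (rule taylor_coeff_cong) (rule z_mult_hit_eq_tau)
  also have "\<dots> = taylor_coeff (\<lambda>z. (-1) * tau z + z * tau z) (Suc n)"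
    by (subst taylor_coeff_add) (auto intro!: holomorphic_intros simp: taylor_coeff_const)
  also have "\<dots> = taylor_coeff (\<lambda>z. (-1) * tau z) (Suc n) + taylor_coeff (\<lambda>z. z * tau z) (Suc n)"
    by (rule taylor_coeff_add) (intro holomorphic_intros)+
  also have "\<dots> = of_real (tau_coeff n - tau_coeff (Suc n))"
    unfolding taylor_coeff_cmult[OF holomorphic_tau] taylor_coeff_shift[OF holomorphic_tau]
    by (simp add: taylor_coeff_tau)
  finally show ?thesis .
qed

lemma coeff_decay_hit: "coeff_decay hit"
proof -
  let ?d = "\<lambda>n. 1 / real n powr (3/2)"
  let ?f = "\<lambda>n. tau_coeff n - sqrt (2 / pi) / sqrt (real n)"
  have "(\<lambda>n. ?f (Suc n)) \<in> O(\<lambda>n. ?d (Suc n))"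
    by (rule landau_o.big.compose[OF tau_coeff_asymp]) (rule filterlim_Suc)
  also have "(\<lambda>n. ?d (Suc n)) \<in> O(?d)" by real_asymp
  finally have 1: "(\<lambda>n. ?f (Suc n)) \<in> O(?d)" .
  have "(\<lambda>n. 1 / sqrt (real (Suc n)) - 1 / sqrt (real n)) \<in> O(?d)" by real_asymp
  hence "(\<lambda>n. sqrt (2 / pi) * (1 / sqrt (real (Suc n)) - 1 / sqrt (real n))) \<in> O(?d)" by simp
  from sum_in_bigo(2)[OF sum_in_bigo(2)[OF tau_coeff_asymp 1] this]
  have "(\<lambda>n. tau_coeff n - tau_coeff (Suc n)) \<in> O(?d)"
    by (simp add: algebra_simps)
  hence "(\<lambda>n. norm (taylor_coeff hit n)) \<in> O(?d)"
    unfolding taylor_coeff_hit norm_of_real by simp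
  thus ?thesis by (simp add: coeff_decay_def holomorphic_hit)
qed

text \<open>By \<open>z * h^(k+2) = 2 * h^(k+1) - z * h^k\<close>, a rearrangement of the first-step equation; two
  consecutive powers are carried along because the recursion has depth two.\<close>
lemma coeff_decay_hit_power: "coeff_decay (\<lambda>z. hit z ^ k) \<and> coeff_decay (\<lambda>z. hit z ^ Suc k)"
proof (induction k)
  case 0
  show ?case using coeff_decay_hit coeff_decay_const[of 1] by simp
next
  case (Suc k)
  have "coeff_decay (\<lambda>z. 2 * hit z ^ Suc k + (-1) * (z * hit z ^ k))"
    using Suc by (intro coeff_decay_add coeff_decay_cmult)
      (auto simp: coeff_decay_mult_z_iff holomorphic_intros)
  moreover have "2 * hit z ^ Suc k + (-1) * (z * hit z ^ k) = z * hit z ^ Suc (Suc k)" for z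
    using arg_cong[OF hit_eq[of z], of "\<lambda>x. x * hit z ^ k"]
    by (simp add: algebra_simps power2_eq_square)
  ultimately have "coeff_decay (\<lambda>z. z * hit z ^ Suc (Suc k))" by (simp only:)
  hence "coeff_decay (\<lambda>z. hit z ^ Suc (Suc k))"
    by (subst (asm) coeff_decay_mult_z_iff) (intro holomorphic_intros)
  thus ?case using Suc by blast
qed

lemma coeff_decay_sum:
  "finite A \<Longrightarrow> (\<And>i. i \<in> A \<Longrightarrow> coeff_decay (f i)) \<Longrightarrow> coeff_decay (\<lambda>z. \<Sum>i\<in>A. f i z)"
  by (induction A rule: finite_induct) (auto simp: coeff_decay_const intro!: coeff_decay_add)

lemma coeff_decay_poly_hit: "coeff_decay (\<lambda>z. poly q (hit z))"
  unfolding poly_altdef using coeff_decay_hit_power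
  by (intro coeff_decay_sum coeff_decay_cmult) auto

lemma holomorphic_poly_hit [holomorphic_intros]: "(\<lambda>z. poly q (hit z)) holomorphic_on ball 0 1"
  using coeff_decay_poly_hit coeff_decay_holo by blast

lemma poly_expand_at_root:
  fixes S D :: "complex poly"
  assumes "poly D r \<noteq> 0"
  shows "\<exists>T. S = smult (poly S r / poly D r) D + [:-r, 1:] * T"
proof -
  have "poly (S - smult (poly S r / poly D r) D) r = 0" using assms by simp
  then obtain T where "S - smult (poly S r / poly D r) D = [:-r, 1:] * T"
    unfolding poly_eq_0_iff_dvd by (auto elim: dvdE)
  thus ?thesis by (metis add.commute diff_add_cancel)
qed

text \<open>Taylor expansion of \<open>S / D\<close> at \<open>r\<close> up to order \<open>k\<close>, without denominators.\<close>
lemma poly_expand_at_root_power: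
  fixes S D :: "complex poly"
  assumes "poly D r \<noteq> 0"
  shows "\<exists>Q T. S = Q * D + [:-r, 1:] ^ k * T"
proof (induction k arbitrary: S)
  case 0
  show ?case by (rule exI[of _ 0]) auto
next
  case (Suc k)
  obtain U where U: "S = smult (poly S r / poly D r) D + [:-r, 1:] * U"
    using poly_expand_at_root[OF assms] by blast
  obtain Q T where Q: "U = Q * D + [:-r, 1:] ^ k * T" using Suc by blast
  have "S = ([:poly S r / poly D r:] + [:-r,1:] * Q) * D + [:-r, 1:] ^ Suc k * T"
    by (subst U, subst Q) (simp add: algebra_simps)
  thus ?case by blast
qed

text \<open>Hermite interpolation at the branch values \<open>1\<close> and \<open>-1\<close>: \<open>S\<close> is a multiple of \<open>D\<close> up to a multiple of
  \<open>(1 - X\<^sup>2)^4\<close>, so \<open>S(h) / D(h)\<close> is a polynomial in \<open>h\<close> plus a quotient with bounded second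
  derivative.\<close>
lemma coeff_decay_rational_hit:
  assumes D: "\<And>z. z \<in> cball 0 1 \<Longrightarrow> poly D (hit z) \<noteq> 0"
  shows "coeff_decay (\<lambda>z. poly S (hit z) / poly D (hit z))"
proof -
  have D1: "poly D 1 \<noteq> 0" "poly D (-1) \<noteq> 0" using D[of 1] D[of "-1"] by (auto simp: hit_endpoints)
  obtain Q T where 1: "S = Q * D + [:-1, 1:] ^ 4 * T"
    using poly_expand_at_root_power[OF D1(1)] by blast
  obtain Q' T' where 2: "T = Q' * D + [:-(-1), 1:] ^ 4 * T'"
    using poly_expand_at_root_power[OF D1(2)] by blast
  have "coeff_decay (\<lambda>z. poly (Q + [:-1, 1:] ^ 4 * Q') (hit z) +
      (1 - (hit z)\<^sup>2) ^ 4 * (poly T' (hit z) / poly D (hit z)))"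
    by (intro coeff_decay_add coeff_decay_poly_hit coeff_decay_vanishing_rational D)
  thus ?thesis
  proof (rule coeff_decay_cong)
    fix z :: complex assume "z \<in> ball 0 1"
    hence nz: "poly D (hit z) \<noteq> 0" using D[of z] by simp
    define x where "x = hit z"
    have "(1 - x\<^sup>2) ^ 4 = (x - 1) ^ 4 * (x + 1) ^ 4"
      unfolding power_mult_distrib[symmetric] by (simp add: power2_eq_square algebra_simps eval_nat_numeral)
    moreover have "poly S x = poly Q x * poly D x + (x - 1) ^ 4 * (poly Q' x * poly D x + (x + 1) ^ 4 * poly T' x)"
      unfolding 1 2 by (simp add: algebra_simps)
    ultimately show "poly (Q + [:-1, 1:] ^ 4 * Q') (hit z) + (1 - (hit z)\<^sup>2) ^ 4 * (poly T' (hit z) / poly D (hit z))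
        = poly S (hit z) / poly D (hit z)"
      using nz unfolding x_def[symmetric] by (simp add: field_simps)
  qed
qed

lemma pderiv_sum: "pderiv (\<Sum>i\<in>A. f i) = (\<Sum>i\<in>A. pderiv (f i))"
  by (induction A rule: infinite_finite_induct) (auto simp: pderiv_add)

text \<open>The Taylor expansion of \<open>S / D\<close> at \<open>r\<close> with explicit coefficients; they are solved for one after
  the other by comparing derivatives of both sides at \<open>r\<close>.\<close>
lemma poly_expand_order_3:
  fixes S D :: "complex poly"
  assumes D: "poly D r \<noteq> 0"
    and a: "a = poly S r / poly D r"
    and b: "b = (poly (pderiv S) r - a * poly (pderiv D) r) / poly D r"
    and c: "c = ((poly (pderiv (pderiv S)) r - a * poly (pderiv (pderiv D)) r) / 2
                  - b * poly (pderiv D) r) / poly D r"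
  shows "\<exists>T. \<forall>x. poly S x = (a + b * (x - r) + c * (x - r)\<^sup>2) * poly D x + (x - r) ^ 3 * poly T x"
proof -
  obtain T1 where T1: "S = smult a D + [:-r, 1:] * T1" using poly_expand_at_root[OF D, of S] a by blast
  obtain T2 where T2: "T1 = smult (poly T1 r / poly D r) D + [:-r, 1:] * T2"
    using poly_expand_at_root[OF D, of T1] by blast
  obtain T3 where T3: "T2 = smult (poly T2 r / poly D r) D + [:-r, 1:] * T3"
    using poly_expand_at_root[OF D, of T2] by blast
  have l: "pderiv [:-r, 1:] = [:1:]" by (simp add: pderiv_pCons)
  have S': "pderiv S = smult a (pderiv D) + [:-r, 1:] * pderiv T1 + T1"
    by (subst T1) (simp only: pderiv_add pderiv_smult pderiv_mult l, simp)
  have S'': "pderiv (pderiv S) = smult a (pderiv (pderiv D)) + [:-r, 1:] * pderiv (pderiv T1) + (pderiv T1 + pderiv T1)"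
    by (subst S') (simp only: pderiv_add pderiv_smult pderiv_mult l, simp add: algebra_simps)
  have T1': "pderiv T1 = smult (poly T1 r / poly D r) (pderiv D) + [:-r, 1:] * pderiv T2 + T2"
    by (subst T2) (simp only: pderiv_add pderiv_smult pderiv_mult l, simp)
  have b': "poly T1 r / poly D r = b" unfolding b S' by simp
  have "poly (pderiv T1) r = b * poly (pderiv D) r + poly T2 r" by (subst T1') (simp add: b')
  moreover have "poly (pderiv (pderiv S)) r = a * poly (pderiv (pderiv D)) r + 2 * poly (pderiv T1) r"
    unfolding S'' by simp
  ultimately have c': "poly T2 r / poly D r = c" unfolding c by (simp add: add_divide_distrib)
  have "poly S x = (a + b * (x - r) + c * (x - r)\<^sup>2) * poly D x + (x - r) ^ 3 * poly T3 x" for x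
  proof -
    have "poly S x = a * poly D x + (x - r) * poly T1 x" by (subst T1) (simp add: algebra_simps)
    moreover have "poly T1 x = b * poly D x + (x - r) * poly T2 x" by (subst T2) (simp add: algebra_simps b')
    moreover have "poly T2 x = c * poly D x + (x - r) * poly T3 x" by (subst T3) (simp add: algebra_simps c')
    ultimately show ?thesis by (simp add: algebra_simps power2_eq_square power3_eq_cube)
  qed
  thus ?thesis by blast
qed

section \<open>The generating function of the mean position\<close>

text \<open>The mean position after \<open>n\<close> steps from \<open>i\<close>, computed by conditioning on the first step. The sum may
  stop at \<open>i + 1 + N\<close>, since no single step from \<open>i\<close> leads further.\<close>
primrec walk_mean :: "(nat \<Rightarrow> real) \<Rightarrow> nat \<Rightarrow> nat \<Rightarrow> nat \<Rightarrow> real" where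
  "walk_mean p N 0 i = real i"
| "walk_mean p N (Suc n) i = (\<Sum>l\<le>i + 1 + N. walk_transition p i l * walk_mean p N n l)"

locale jump_law =
  fixes p :: "nat \<Rightarrow> real" and N :: nat
  assumes p_nonneg: "\<And>k. p k \<ge> 0"
    and p_sums: "p sums 1"
    and p_0_less_1: "p 0 < 1"
    and even_jump: "\<exists>k. even k \<and> p k > 0"
    and p_beyond: "\<And>k. k > N \<Longrightarrow> p k = 0"
begin

lemma sum_p: "(\<Sum>k\<le>N. p k) = 1"
proof -
  have "p sums (\<Sum>k\<le>N. p k)" by (rule sums_finite) (auto simp: p_beyond)
  thus ?thesis using p_sums sums_unique2 by blast
qed

lemma moment_eq: "moment p m = (\<Sum>k\<le>N. p k * real k ^ m)"
  unfolding moment_def by (rule suminf_finite) (auto simp: p_beyond)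

lemma positive_jump: obtains k where "k > 0" "k \<le> N" "p k > 0"
proof -
  have "\<exists>k\<in>{..N}. k > 0 \<and> p k > 0"
  proof (rule ccontr)
    assume "\<not> ?thesis"
    hence "p k = 0" if "k \<in> {..N} - {0}" for k using that p_nonneg[of k] by fastforce
    hence "(\<Sum>k\<le>N. p k) = (\<Sum>k\<in>{0}. p k)" by (intro sum.mono_neutral_right) auto
    thus False using sum_p p_0_less_1 by simp
  qed
  thus ?thesis using that by auto
qed

lemma moment_1_pos: "moment p 1 > 0"
proof -
  obtain k where k: "k > 0" "k \<le> N" "p k > 0" using positive_jump .
  have "0 < p k * real k ^ 1" using k by simp
  also have "\<dots> \<le> (\<Sum>k\<le>N. p k * real k ^ 1)"
    by (rule member_le_sum) (use k p_nonneg in auto)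
  finally show ?thesis by (simp add: moment_eq)
qed

definition jump_poly :: "complex poly" where
  "jump_poly = (\<Sum>k\<le>N. monom (complex_of_real (p k)) k)"

lemma poly_jump_poly: "poly jump_poly x = (\<Sum>k\<le>N. of_real (p k) * x ^ k)"
  by (simp add: jump_poly_def poly_sum poly_monom)

lemma norm_jump_poly_le:
  "norm (poly jump_poly x) \<le> (\<Sum>k\<le>N. p k * norm x ^ k)"
  unfolding poly_jump_poly
  by (rule sum_norm_le) (simp add: norm_mult norm_power p_nonneg)

text \<open>Some jump \<open>k > 0\<close> has positive probability, and its contribution is strictly diminished.\<close>
lemma norm_jump_poly_less_1:
  assumes "norm x < 1" shows "norm (poly jump_poly x) < 1"
proof -
  obtain k where k: "k > 0" "k \<le> N" "p k > 0" using positive_jump .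
  have "norm (poly jump_poly x) \<le> (\<Sum>k\<le>N. p k * norm x ^ k)" by (rule norm_jump_poly_le)
  also have "\<dots> < (\<Sum>k\<le>N. p k)"
  proof (rule sum_strict_mono_ex1)
    show "\<forall>k\<in>{..N}. p k * norm x ^ k \<le> p k"
      using assms p_nonneg by (auto intro!: mult_left_le power_le_one)
    have "norm x ^ k < 1" using assms k by (simp add: power_less_one_iff)
    thus "\<exists>k\<in>{..N}. p k * norm x ^ k < p k" using k by (intro bexI[of _ k]) auto
  qed simp
  finally show ?thesis using sum_p by simp
qed

lemma poly_jump_poly_1: "poly jump_poly 1 = 1"
  unfolding poly_jump_poly using sum_p by (simp flip: of_real_sum)

lemma poly_jump_poly_neg_1: "poly jump_poly (-1) \<noteq> -1"
proof
  assume "poly jump_poly (-1) = -1"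
  hence "of_real (\<Sum>k\<le>N. p k * (-1) ^ k) = (of_real (-1) :: complex)" unfolding poly_jump_poly by simp
  hence "(\<Sum>k\<le>N. p k * (-1) ^ k) = -1" by (simp only: of_real_eq_iff)
  hence "(\<Sum>k\<le>N. p k * (1 + (-1) ^ k)) = 0" using sum_p by (simp add: distrib_left sum.distrib)
  moreover obtain k where k: "even k" "p k > 0" using even_jump by blast
  moreover have "k \<le> N" using k p_beyond[of k] by force
  moreover have "p k * (1 + (-1) ^ k) \<le> (\<Sum>k\<le>N. p k * (1 + (-1) ^ k))"
    by (rule member_le_sum) (use \<open>k \<le> N\<close> p_nonneg in \<open>auto simp: minus_one_power_iff\<close>)
  ultimately show False by simp
qed

text \<open>\<open>1 - z * P(hit z)\<close> is the reciprocal of the generating function of the visits to the origin. For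
  \<open>z \<noteq> 1, -1\<close> the product \<open>z * P(hit z)\<close> has modulus below 1, and at \<open>z = -1\<close> the possibility of an
  even jump excludes \<open>P(-1) = -1\<close>.\<close>
lemma return_gf_nonzero:
  assumes "z \<in> cball 0 1" "z \<noteq> 1"
  shows "1 - z * poly jump_poly (hit z) \<noteq> 0"
proof (cases "z = -1")
  case True
  thus ?thesis using poly_jump_poly_neg_1 by (auto simp: hit_endpoints add_eq_0_iff)
next
  case False
  have z: "norm z \<le> 1" using assms by simp
  have "norm (z * poly jump_poly (hit z)) \<le> 1 * norm (poly jump_poly (hit z))"
    unfolding norm_mult using z by (intro mult_right_mono) auto
  also have "\<dots> < 1" using norm_jump_poly_less_1 norm_hit_less_1[OF z assms(2) False] by simp
  finally show ?thesis by auto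
qed

lemma walk_poly_eq: "walk_poly p N = [:1, 0, 1:] - [:0, 2:] * jump_poly"
  by (simp add: walk_poly_def jump_poly_def)

lemma poly_walk_poly_hit:
  "poly (walk_poly p N) (hit z) = (1 + (hit z)\<^sup>2) * (1 - z * poly jump_poly (hit z))"
proof -
  have "(1 + (hit z)\<^sup>2) * (1 - z * poly jump_poly (hit z))
      = (1 + (hit z)\<^sup>2) - z * (1 + (hit z)\<^sup>2) * poly jump_poly (hit z)" by (simp add: algebra_simps)
  also have "\<dots> = poly (walk_poly p N) (hit z)"
    unfolding hit_eq by (simp add: walk_poly_eq power2_eq_square algebra_simps)
  finally show ?thesis ..
qed

lemma pderivs_walk_poly_1:
  "poly (pderiv (walk_poly p N)) 1 = - 2 * of_real (moment p 1)" (is ?A)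
  "poly (pderiv (pderiv (walk_poly p N))) 1 = 2 - 2 * of_real (moment p 2 + moment p 1)" (is ?B)
  "poly (pderiv (pderiv (pderiv (walk_poly p N)))) 1 = - 2 * of_real (moment p 3 - moment p 1)" (is ?C)
proof -
  have w: "walk_poly p N = [:1, 0, 1:] - (\<Sum>k\<le>N. monom (of_real (2 * p k)) (Suc k))"
  proof -
    have "[:0, 2:] * jump_poly = (\<Sum>k\<le>N. monom (of_real (2 * p k)) (Suc k))"
      unfolding jump_poly_def sum_distrib_left
      by (intro sum.cong refl) (simp add: monom_Suc smult_monom)
    thus ?thesis by (simp add: walk_poly_eq)
  qed
  have 1: "poly (pderiv (walk_poly p N)) 1 = 2 - of_real (\<Sum>k\<le>N. 2 * p k * (real k + 1))"
    unfolding w pderiv_diff pderiv_sum pderiv_monom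
    by (simp add: poly_sum poly_monom pderiv_pCons algebra_simps)
  have 2: "poly (pderiv (pderiv (walk_poly p N))) 1 = 2 - of_real (\<Sum>k\<le>N. 2 * p k * (real k + 1) * real k)"
    unfolding w pderiv_diff pderiv_sum pderiv_monom
    by (simp add: poly_sum poly_monom pderiv_pCons algebra_simps)
  have 3: "poly (pderiv (pderiv (pderiv (walk_poly p N)))) 1 = - of_real (\<Sum>k\<le>N. 2 * p k * (real k + 1) * real k * (real k - 1))"
  proof -
    have "poly (pderiv (pderiv (pderiv (monom c (Suc k))))) 1 = c * (of_nat k + 1) * of_nat k * (of_nat k - 1)"
      for c :: complex and k
      by (cases k) (simp_all add: pderiv_monom poly_monom algebra_simps)
    thus ?thesis
      unfolding w pderiv_diff pderiv_sum by (simp add: poly_sum pderiv_pCons)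
  qed
  have "(\<Sum>k\<le>N. 2 * p k * (real k + 1)) = 2 * moment p 1 + 2 * (\<Sum>k\<le>N. p k)"
    unfolding moment_eq sum_distrib_left sum.distrib[symmetric] by (simp add: algebra_simps)
  thus ?A unfolding 1 sum_p by simp
  have "(\<Sum>k\<le>N. 2 * p k * (real k + 1) * real k) = 2 * (moment p 2 + moment p 1)"
    unfolding moment_eq sum_distrib_left sum.distrib[symmetric] by (simp add: algebra_simps power2_eq_square)
  thus ?B unfolding 2 by simp
  have "(\<Sum>k\<le>N. 2 * p k * (real k + 1) * real k * (real k - 1)) = 2 * (moment p 3 - moment p 1)"
    unfolding moment_eq sum_distrib_left sum_subtractf[symmetric] by (simp add: algebra_simps power3_eq_cube)
  thus ?C unfolding 3 by simp
qed

text \<open>The zero of the walk polynomial at 1 accounts for the growth of the mean; with it divided out, no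
  zero remains on the image of the closed disc under \<^const>\<open>hit\<close>.\<close>
definition cofactor :: "complex poly" where
  "cofactor = - (walk_poly p N div [:-1, 1:])"

lemma walk_poly_factor: "walk_poly p N = [:1, -1:] * cofactor"
proof -
  have "poly (walk_poly p N) 1 = 0" by (simp add: walk_poly_eq poly_jump_poly_1)
  hence "walk_poly p N = [:-1, 1:] * (walk_poly p N div [:-1, 1:])"
    unfolding poly_eq_0_iff_dvd by (simp only: dvd_mult_div_cancel)
  also have "\<dots> = - [:-1, 1:] * cofactor" unfolding cofactor_def by (simp only: minus_mult_minus)
  also have "- [:-1, 1:] = [:1, -1 :: complex:]" by simp
  finally show ?thesis .
qed

lemma poly_cofactor_1:
  "poly cofactor 1 = of_real (2 * moment p 1)"
  "poly (pderiv cofactor) 1 = of_real (moment p 2 + moment p 1 - 1)"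
  "poly (pderiv (pderiv cofactor)) 1 = of_real (2 / 3 * (moment p 3 - moment p 1))"
proof -
  have l: "pderiv [:1, -1 :: complex:] = [:-1:]" by (simp add: pderiv_pCons)
  have 1: "pderiv (walk_poly p N) = [:1, -1:] * pderiv cofactor - cofactor"
    by (simp only: walk_poly_factor pderiv_mult l) simp
  have 2: "pderiv (pderiv (walk_poly p N)) = [:1, -1:] * pderiv (pderiv cofactor) - (pderiv cofactor + pderiv cofactor)"
    by (simp only: 1 pderiv_diff pderiv_mult l) simp
  have 3: "pderiv (pderiv (pderiv (walk_poly p N))) = [:1, -1:] * pderiv (pderiv (pderiv cofactor))
      - (pderiv (pderiv cofactor) + pderiv (pderiv cofactor) + pderiv (pderiv cofactor))"
    by (simp only: 2 pderiv_diff pderiv_add pderiv_mult l) simp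
  show "poly cofactor 1 = of_real (2 * moment p 1)"
    using pderivs_walk_poly_1(1) unfolding 1 by simp
  show "poly (pderiv cofactor) 1 = of_real (moment p 2 + moment p 1 - 1)"
  proof -
    have "2 * poly (pderiv cofactor) 1 = 2 * of_real (moment p 2 + moment p 1 - 1)"
      using pderivs_walk_poly_1(2) unfolding 2 by (simp add: algebra_simps)
    thus ?thesis by (simp only: mult_cancel_left) simp
  qed
  show "poly (pderiv (pderiv cofactor)) 1 = of_real (2 / 3 * (moment p 3 - moment p 1))"
  proof -
    have "3 * poly (pderiv (pderiv cofactor)) 1 = 3 * of_real (2 / 3 * (moment p 3 - moment p 1))"
      using pderivs_walk_poly_1(3) unfolding 3 by (simp add: algebra_simps)
    thus ?thesis by (simp only: mult_cancel_left) simp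
  qed
qed

lemma cofactor_hit_nonzero:
  assumes "z \<in> cball 0 1" shows "poly cofactor (hit z) \<noteq> 0"
proof (cases "z = 1")
  case True
  thus ?thesis using moment_1_pos by (simp add: hit_endpoints poly_cofactor_1)
next
  case False
  have "poly (walk_poly p N) (hit z) \<noteq> 0"
    unfolding poly_walk_poly_hit using return_gf_nonzero[OF assms False] one_plus_hit_sq_nonzero by simp
  thus ?thesis by (auto simp: walk_poly_factor)
qed

text \<open>Away from the origin the walk has no drift and at the origin its drift is \<open>E(Y)\<close>, so the mean is the
  starting point plus \<open>E(Y)\<close> times the expected number of visits to 0 before time \<open>n\<close>. The probabilities
  of being at 0 have the generating function \<open>hit z ^ i / (1 - z * P(hit z))\<close>, and the factor
  \<open>z / (1 - z)\<close> adds them up over the times before \<open>n\<close>.\<close>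
definition mean_gf :: "nat \<Rightarrow> complex \<Rightarrow> complex" where
  "mean_gf i z = of_nat i / (1 - z) +
     of_real (moment p 1) * (z / (1 - z)) * (hit z ^ i / (1 - z * poly jump_poly (hit z)))"

lemma holomorphic_mean_gf [holomorphic_intros]: "mean_gf i holomorphic_on ball 0 1"
  unfolding mean_gf_def
proof (intro holomorphic_intros)
  fix z :: complex assume z: "z \<in> ball 0 1"
  show "1 - z \<noteq> 0" using z by auto
  thus "1 - z \<noteq> 0" .
  show "1 - z * poly jump_poly (hit z) \<noteq> 0" using z by (intro return_gf_nonzero) auto
qed

lemma sum_walk_transition_0:
  "(\<Sum>l\<le>0 + 1 + N. of_real (walk_transition p 0 l) * f l) = (\<Sum>l\<le>N. complex_of_real (p l) * f l)"
  by (simp add: walk_transition_def p_beyond)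

lemma sum_walk_transition_Suc:
  "(\<Sum>l\<le>Suc k + 1 + N. of_real (walk_transition p (Suc k) l) * f l) = (f k + f (k + 2)) / (2 :: complex)"
proof -
  have "(\<Sum>l\<le>Suc k + 1 + N. of_real (walk_transition p (Suc k) l) * f l) =
      (\<Sum>l\<in>{k, k + 2}. of_real (walk_transition p (Suc k) l) * f l)"
    by (rule sum.mono_neutral_right) (auto simp: walk_transition_def)
  thus ?thesis by (simp add: walk_transition_def add_divide_distrib)
qed

lemma mean_gf_functional_equation:
  assumes z: "z \<in> ball 0 1"
  shows "mean_gf i z = of_nat i + z * (\<Sum>l\<le>i + 1 + N. of_real (walk_transition p i l) * mean_gf l z)"
proof -
  define h u m where "h = hit z" and "u = 1 - z * poly jump_poly (hit z)" and "m = complex_of_real (moment p 1)"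
  define v w where "v = 1 / (1 - z)" and "w = m * (z / (1 - z)) / u"
  have nz: "1 - z \<noteq> 0" "u \<noteq> 0" using z return_gf_nonzero[of z] by (cases "z = 1"; auto simp: u_def)+
  have v: "v * (1 - z) = 1" and w: "w * u = m * z * v" using nz by (simp_all add: v_def w_def)
  have gf: "mean_gf i z = of_nat i * v + w * h ^ i" for i
    by (simp add: mean_gf_def m_def u_def h_def v_def w_def)
  show ?thesis
  proof (cases i)
    case 0
    have "(\<Sum>l\<le>N. of_real (p l) * mean_gf l z) =
        (\<Sum>l\<le>N. v * of_real (p l * real l ^ 1) + w * (of_real (p l) * h ^ l))"
      unfolding gf by (intro sum.cong refl) (simp add: algebra_simps)
    also have "\<dots> = v * m + w * poly jump_poly h"
      unfolding sum.distrib sum_distrib_left[symmetric] poly_jump_poly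
        of_real_sum[symmetric] m_def moment_eq ..
    finally have s: "(\<Sum>l\<le>N. of_real (p l) * mean_gf l z) = v * m + w * poly jump_poly h" .
    have "z * (v * m + w * poly jump_poly h) = w * u + w * (z * poly jump_poly h)"
      unfolding w by (simp add: algebra_simps)
    also have "\<dots> = w" by (simp add: u_def h_def algebra_simps)
    finally show ?thesis unfolding 0 sum_walk_transition_0 s by (simp add: gf)
  next
    case (Suc k)
    \<comment> \<open>For positive positions the equation is linear in the starting point plus a multiple of
       \<open>h ^ i\<close>, and the latter solves the homogeneous equation by the first-step equation for \<open>h\<close>.\<close>
    have "2 * (mean_gf i z - z * ((mean_gf k z + mean_gf (k + 2) z) / 2)) =
        2 * of_nat i * (v * (1 - z)) + w * h ^ k * (2 * h - z * (1 + h\<^sup>2))"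
      unfolding gf Suc by (simp add: algebra_simps power2_eq_square)
    also have "\<dots> = 2 * of_nat i"
      unfolding h_def hit_eq v by simp
    finally have "mean_gf i z - z * ((mean_gf k z + mean_gf (k + 2) z) / 2) = of_nat i"
      by (simp only: mult_cancel_left) simp
    thus ?thesis unfolding Suc sum_walk_transition_Suc by (simp add: diff_eq_eq)
  qed
qed

text \<open>The functional equation says that the coefficients obey the recursion that defines
  \<^const>\<open>walk_mean\<close>.\<close>
lemma taylor_coeff_mean_gf: "taylor_coeff (mean_gf i) n = of_real (walk_mean p N n i)"
proof (induction n arbitrary: i)
  case 0
  show ?case by (simp add: taylor_coeff_0 mean_gf_def)
next
  case (Suc n)
  let ?s = "\<lambda>z. \<Sum>l\<le>i + 1 + N. of_real (walk_transition p i l) * mean_gf l z"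
  have hol: "?s holomorphic_on ball 0 1" by (intro holomorphic_intros)
  have "taylor_coeff (mean_gf i) (Suc n) = taylor_coeff (\<lambda>z. of_nat i + z * ?s z) (Suc n)"
    by (rule taylor_coeff_cong) (rule mean_gf_functional_equation)
  also have "\<dots> = taylor_coeff (\<lambda>z. z * ?s z) (Suc n)"
    by (subst taylor_coeff_add) (auto intro!: holomorphic_intros simp: taylor_coeff_const)
  also have "\<dots> = taylor_coeff ?s n" by (rule taylor_coeff_shift[OF hol])
  also have "\<dots> = (\<Sum>l\<le>i + 1 + N. of_real (walk_transition p i l) * taylor_coeff (mean_gf l) n)"
    by (subst taylor_coeff_sum, intro holomorphic_intros) (simp add: taylor_coeff_cmult holomorphic_intros)
  finally show ?case by (simp add: Suc)
qed

section \<open>The expansion of the mean position\<close>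

text \<open>Expressed by \<open>h = hit z\<close>, the visit part of the generating function is
  \<open>2*E(Y) * h^(j+1) * (1 + h\<^sup>2) / ((1 - h)^3 * C(h))\<close> with \<open>C\<close> the cofactor. The numerator is expanded in
  multiples of \<open>C\<close> up to \<open>(1 - h)^3\<close>; this splits off the polar part
  \<open>2 / (1 - h)^3 + a1 / (1 - h)\<^sup>2 + a2 / (1 - h)\<close>, which \<open>1 / (1 - h) = (tau + 1) / 2\<close> turns into
  powers of \<open>tau\<close>.\<close>
lemma mean_gf_decomposition:
  assumes d: "d = (moment p 2 - 1) / moment p 1"
    and a1: "a1 = d - 2 * real j - 3"
    and a2: "a2 = (real j)\<^sup>2 + 3 * real j + 3 + a1 * (d + 1) / 2 - (moment p 3 / moment p 1 - 1) / 3"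
  obtains T where "\<And>z. z \<in> ball 0 1 \<Longrightarrow> mean_gf j z =
      1 / 4 * tau z ^ 3 + (of_real (3 / 4 + a1 / 2 + a2 / 2) * tau z +
      (of_real (d / 2) * (1 / (1 - z)) +
      (of_real (a2 / 2 - 1 / 2) + (-1) * (poly T (hit z) / poly cofactor (hit z)))))"
proof -
  let ?m = "moment p"
  define S where "S = smult (complex_of_real (2 * ?m 1)) (monom 1 (Suc j) + monom 1 (Suc (Suc (Suc j))))"
  have m1: "?m 1 \<noteq> 0" using moment_1_pos by simp
  have md: "?m 2 = 1 + d * ?m 1" unfolding d using m1 by simp
  have c0: "poly cofactor 1 \<noteq> 0" using m1 by (simp add: poly_cofactor_1)
  have S: "poly S 1 = of_real (4 * ?m 1)"
          "poly (pderiv S) 1 = of_real (2 * ?m 1 * (2 * real j + 4))"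
          "poly (pderiv (pderiv S)) 1 = of_real (2 * ?m 1 * (2 * (real j)\<^sup>2 + 6 * real j + 6))"
    by (simp_all add: S_def poly_monom pderiv_smult pderiv_add pderiv_monom power2_eq_square algebra_simps)
  have "\<exists>T. \<forall>x. poly S x = (2 + of_real (- a1) * (x - 1) + of_real a2 * (x - 1)\<^sup>2) * poly cofactor x
      + (x - 1) ^ 3 * poly T x"
  proof (rule poly_expand_order_3[OF c0])
    show "2 = poly S 1 / poly cofactor 1" unfolding S poly_cofactor_1 using m1 by simp
    have "- a1 = (2 * ?m 1 * (2 * real j + 4) - 2 * (?m 2 + ?m 1 - 1)) / (2 * ?m 1)"
      unfolding a1 md using m1 by (simp add: field_simps)
    thus "of_real (- a1) = (poly (pderiv S) 1 - 2 * poly (pderiv cofactor) 1) / poly cofactor 1"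
      unfolding S poly_cofactor_1 by (simp del: of_real_minus)
    have "a2 = ((2 * ?m 1 * (2 * (real j)\<^sup>2 + 6 * real j + 6) - 2 * (2 / 3 * (?m 3 - ?m 1))) / 2
        - (- a1) * (?m 2 + ?m 1 - 1)) / (2 * ?m 1)"
      unfolding a2 md using m1 by (simp add: field_simps)
    thus "of_real a2 = ((poly (pderiv (pderiv S)) 1 - 2 * poly (pderiv (pderiv cofactor)) 1) / 2
        - of_real (- a1) * poly (pderiv cofactor) 1) / poly cofactor 1"
      unfolding S poly_cofactor_1 by simp
  qed
  then obtain T where T: "\<And>x. poly S x = (2 + of_real (- a1) * (x - 1) + of_real a2 * (x - 1)\<^sup>2) * poly cofactor x
      + (x - 1) ^ 3 * poly T x" by blast
  show ?thesis
  proof (rule that[of T])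
    fix z :: complex assume z: "z \<in> ball 0 1"
    define h t v where "h = hit z" and "t = tau z" and "v = 1 / (1 - z)"
    define c where "c = poly cofactor h"
    have z1: "z \<noteq> 1" using z by auto
    have nz: "c \<noteq> 0" "1 - h \<noteq> 0" "1 + h\<^sup>2 \<noteq> 0" "1 - z \<noteq> 0"
      using cofactor_hit_nonzero[of z] z hit_neq_pm1[OF z] one_plus_hit_sq_nonzero[of z] z1
      by (auto simp: c_def h_def)
    have s: "1 / (1 - h) = (t + 1) / 2" unfolding h_def t_def by (rule inverse_one_minus_hit[OF z])
    have t2: "t\<^sup>2 = 2 * v - 1"
      using tau_sq[OF z] nz unfolding t_def v_def by (simp add: field_simps)
    have u: "1 - z * poly jump_poly h = (1 - h) * c / (1 + h\<^sup>2)"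
      using poly_walk_poly_hit[of z] nz unfolding walk_poly_factor h_def c_def by (simp add: field_simps)
    have zz: "z / (1 - z) = 2 * h / (1 - h)\<^sup>2"
    proof -
      have "2 * h = z * (1 + h\<^sup>2)" unfolding h_def hit_eq ..
      moreover have "(1 - h)\<^sup>2 = (1 - z) * (1 + h\<^sup>2)"
        using one_minus_z_eq_hit[of z] nz unfolding h_def by (simp add: field_simps)
      ultimately show ?thesis using nz by simp
    qed
    have "of_real (?m 1) * (z / (1 - z)) * (h ^ j / (1 - z * poly jump_poly h)) = poly S h / ((1 - h) ^ 3 * c)"
      unfolding u zz S_def using nz
      by (simp add: poly_monom divide_simps) (simp add: power2_eq_square power3_eq_cube algebra_simps)
    also have "poly S h = (2 + of_real a1 * (1 - h) + of_real a2 * (1 - h)\<^sup>2) * c - (1 - h) ^ 3 * poly T h"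
      unfolding T c_def h_def by (simp add: power2_eq_square power3_eq_cube algebra_simps)
    also have "\<dots> / ((1 - h) ^ 3 * c)
       = 2 * (1 / (1 - h)) ^ 3 + of_real a1 * (1 / (1 - h))\<^sup>2 + of_real a2 * (1 / (1 - h)) - poly T h / c"
    proof -
      have "((2 + a * w + b * w\<^sup>2) * c - w ^ 3 * y) / (w ^ 3 * c)
          = 2 * (1 / w) ^ 3 + a * (1 / w)\<^sup>2 + b * (1 / w) - y / c" if "w \<noteq> 0" for a b w y
        using that nz(1) by (simp add: field_simps power2_eq_square power3_eq_cube)
      from this[OF nz(2)] show ?thesis .
    qed
    also have "\<dots> = 2 * ((t + 1) / 2) ^ 3 + of_real a1 * ((t + 1) / 2)\<^sup>2 + of_real a2 * ((t + 1) / 2) - poly T h / c"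
      unfolding s ..
    also have "2 * ((t + 1) / 2) ^ 3 = t ^ 3 / 4 + 3 / 4 * t\<^sup>2 + 3 / 4 * t + 1 / 4"
      by (simp add: power3_eq_cube power2_eq_square field_simps)
    also have "((t + 1) / 2)\<^sup>2 = (t\<^sup>2 + 2 * t + 1) / 4"
      by (simp add: power2_eq_square field_simps)
    finally have "mean_gf j z = of_nat j * v + (t ^ 3 / 4 + 3 / 4 * (2 * v - 1) + 3 / 4 * t + 1 / 4
        + of_real a1 * ((2 * v - 1 + 2 * t + 1) / 4) + of_real a2 * ((t + 1) / 2) - poly T h / c)"
      unfolding mean_gf_def t2 by (simp add: h_def v_def)
    moreover have "d / 2 = real j + 3 / 2 + a1 / 2" unfolding a1 by (simp add: field_simps)
    hence "complex_of_real (d / 2) = of_nat j + 3 / 2 + of_real a1 / 2" by simp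
    ultimately show "mean_gf j z =
      1 / 4 * tau z ^ 3 + (of_real (3 / 4 + a1 / 2 + a2 / 2) * tau z +
      (of_real (d / 2) * (1 / (1 - z)) +
      (of_real (a2 / 2 - 1 / 2) + (-1) * (poly T (hit z) / poly cofactor (hit z)))))"
      unfolding c_def[symmetric] h_def[symmetric] t_def[symmetric] v_def[symmetric]
      by (simp add: algebra_simps add_divide_distrib diff_divide_distrib)
  qed
qed

text \<open>Comparing Taylor coefficients in the decomposition: \<open>tau^3 / 4\<close> yields the term \<open>sqrt n\<close>, the simple
  pole \<open>1 / (1 - z)\<close> the constant, \<open>tau\<close> the term \<open>1 / sqrt n\<close>, and the remainder only the error.\<close>
lemma walk_mean_asymp:
  "(\<lambda>n. walk_mean p N n j -
      (2 / sqrt (2 * pi) * sqrt (real n)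
       + (moment p 2 - 1) / (2 * moment p 1)
       + 1 / sqrt (2 * pi)
         * (1 / 3 - moment p 3 / (3 * moment p 1)
            + (moment p 2 - 1)\<^sup>2 / (2 * (moment p 1)\<^sup>2)
            - real j * ((moment p 2 - 1) / moment p 1)
            + (real j)\<^sup>2)
         * (1 / sqrt (real n))))
    \<in> O(\<lambda>n. 1 / real n powr (3 / 2))"
proof -
  let ?d = "\<lambda>n. 1 / real n powr (3 / 2)"
  define d where "d = (moment p 2 - 1) / moment p 1"
  define a1 where "a1 = d - 2 * real j - 3"
  define a2 where "a2 = (real j)\<^sup>2 + 3 * real j + 3 + a1 * (d + 1) / 2 - (moment p 3 / moment p 1 - 1) / 3"
  define c where "c = 3 / 4 + a1 / 2 + a2 / 2"
  define b where "b = 1 / 3 - moment p 3 / (3 * moment p 1) + (moment p 2 - 1)\<^sup>2 / (2 * (moment p 1)\<^sup>2)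
            - real j * ((moment p 2 - 1) / moment p 1) + (real j)\<^sup>2"
  \<comment> \<open>\<open>c\<close> multiplies \<open>tau\<close>, whose coefficients behave like \<open>(2 / sqrt (2 * pi)) / sqrt n\<close>.\<close>
  have b: "b = 2 * c"
  proof -
    define r where "r = moment p 3 / moment p 1"
    have "b = 1 / 3 - r / 3 + d\<^sup>2 / 2 - real j * d + (real j)\<^sup>2"
      by (simp add: b_def d_def r_def power_divide)
    thus ?thesis unfolding c_def a2_def a1_def r_def[symmetric]
      by (simp add: algebra_simps power2_eq_square add_divide_distrib diff_divide_distrib)
  qed
  obtain T where T: "\<And>z. z \<in> ball 0 1 \<Longrightarrow> mean_gf j z = 1 / 4 * tau z ^ 3 + (of_real c * tau z +
      (of_real (d / 2) * (1 / (1 - z)) +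
      (of_real (a2 / 2 - 1 / 2) + (-1) * (poly T (hit z) / poly cofactor (hit z)))))"
    using mean_gf_decomposition[OF d_def a1_def a2_def] unfolding c_def by blast
  define R where "R = (\<lambda>z. of_real (a2 / 2 - 1 / 2) + (-1) * (poly T (hit z) / poly cofactor (hit z)))"
  have R: "coeff_decay R" unfolding R_def
    by (intro coeff_decay_add coeff_decay_cmult coeff_decay_const coeff_decay_rational_hit cofactor_hit_nonzero)
  have holR: "R holomorphic_on ball 0 1" using R by (rule coeff_decay_holo)
  have holg: "(\<lambda>z::complex. 1 / (1 - z)) holomorphic_on ball 0 1"
    by (intro holomorphic_intros) auto
  have "of_real (walk_mean p N n j) =
     of_real (1 / 4 * tau_cube_coeff n + c * tau_coeff n + d / 2) + taylor_coeff R n" for n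
  proof -
    have "of_real (walk_mean p N n j) = taylor_coeff (mean_gf j) n" by (simp add: taylor_coeff_mean_gf)
    also have "\<dots> = taylor_coeff (\<lambda>z. 1 / 4 * tau z ^ 3 + (of_real c * tau z +
        (of_real (d / 2) * (1 / (1 - z)) + R z))) n"
      unfolding R_def by (rule taylor_coeff_cong) (rule T)
    also have "\<dots> = taylor_coeff (\<lambda>z. 1 / 4 * tau z ^ 3) n + (taylor_coeff (\<lambda>z. of_real c * tau z) n
        + (taylor_coeff (\<lambda>z. of_real (d / 2) * (1 / (1 - z))) n + taylor_coeff R n))"
      by (subst taylor_coeff_add, (intro holomorphic_intros holg holR)+)+ (rule refl)
    also have "\<dots> = 1 / 4 * of_real (tau_cube_coeff n) + (of_real c * of_real (tau_coeff n)
        + (of_real (d / 2) * 1 + taylor_coeff R n))"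
      by (subst taylor_coeff_cmult, intro holomorphic_intros holg)+
         (simp only: taylor_coeff_tau taylor_coeff_tau_cube taylor_coeff_geometric)
    finally show ?thesis by simp
  qed
  hence "taylor_coeff R n = of_real (walk_mean p N n j - (1 / 4 * tau_cube_coeff n + c * tau_coeff n + d / 2))" for n
    by (simp add: algebra_simps)
  with R have 1: "(\<lambda>n. walk_mean p N n j - (1 / 4 * tau_cube_coeff n + c * tau_coeff n + d / 2)) \<in> O(?d)"
    unfolding coeff_decay_def by (simp only: norm_of_real landau_o.big.abs_in_iff)
  have 2: "(\<lambda>n. 1 / 4 * (tau_cube_coeff n - 4 * sqrt (2 / pi) * sqrt (real n))) \<in> O(?d)"
    using tau_cube_coeff_asymp by simp
  have 3: "(\<lambda>n. c * (tau_coeff n - sqrt (2 / pi) / sqrt (real n))) \<in> O(?d)"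
    using tau_coeff_asymp by (cases "c = 0") simp_all
  have "(\<lambda>n. (walk_mean p N n j - (1 / 4 * tau_cube_coeff n + c * tau_coeff n + d / 2))
      + 1 / 4 * (tau_cube_coeff n - 4 * sqrt (2 / pi) * sqrt (real n))
      + c * (tau_coeff n - sqrt (2 / pi) / sqrt (real n))) \<in> O(?d)"
    by (rule sum_in_bigo(1)[OF sum_in_bigo(1)[OF 1 2] 3])
  moreover have "sqrt (2 / pi) = 2 / sqrt (2 * pi)"
    by (simp add: real_sqrt_divide real_sqrt_mult field_simps)
  moreover have "d / 2 = (moment p 2 - 1) / (2 * moment p 1)" by (simp add: d_def)
  ultimately show ?thesis
    unfolding b_def[symmetric] b by (simp add: algebra_simps)
qed

end

section \<open>Means of the Markov chain\<close>

text \<open>The Markov property speaks of histories of positive probability only; for the others both sides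
  vanish.\<close>
lemma (in homogeneous_markov_chain) prob_path_step:
  "\<P>(\<omega> in M. (\<forall>i\<le>n. X i \<omega> = x i) \<and> X (Suc n) \<omega> = k) = \<P>(\<omega> in M. \<forall>i\<le>n. X i \<omega> = x i) * K (x n) k"
proof (cases "\<P>(\<omega> in M. \<forall>i\<le>n. X i \<omega> = x i) > 0")
  case True
  from markov[OF this, of k] True show ?thesis
    by (simp add: cond_prob_def field_simps conj_commute)
next
  case False
  note random_variable_X [measurable]
  have "\<P>(\<omega> in M. (\<forall>i\<le>n. X i \<omega> = x i) \<and> X (Suc n) \<omega> = k) \<le> \<P>(\<omega> in M. \<forall>i\<le>n. X i \<omega> = x i)"
    by (rule finite_measure_mono) auto
  thus ?thesis using False by (simp add: order_antisym measure_le_0_iff not_less)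
qed

text \<open>The statement is made for arbitrary histories rather than for \<open>X 0 = j\<close> alone, because the induction
  on \<open>m\<close> extends the history by the next position \<open>l\<close>; only finitely many \<open>l\<close> have positive probability.\<close>
lemma (in jump_law) path_mean_sums:
  assumes "homogeneous_markov_chain M X (walk_transition p)"
  shows "(\<lambda>k. real k * \<P>(\<omega> in M. (\<forall>i\<le>n. X i \<omega> = x i) \<and> X (n + m) \<omega> = k)) sums
           (\<P>(\<omega> in M. \<forall>i\<le>n. X i \<omega> = x i) * walk_mean p N m (x n))"
proof -
  interpret homogeneous_markov_chain M X "walk_transition p" by fact
  note random_variable_X [measurable]
  show ?thesis
  proof (induction m arbitrary: n x)
    case 0
    have "real k * \<P>(\<omega> in M. (\<forall>i\<le>n. X i \<omega> = x i) \<and> X (n + 0) \<omega> = k) =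
       (if k = x n then real k * \<P>(\<omega> in M. \<forall>i\<le>n. X i \<omega> = x i) else 0)" for k
    proof (cases "k = x n")
      case True
      hence "{\<omega> \<in> space M. (\<forall>i\<le>n. X i \<omega> = x i) \<and> X (n + 0) \<omega> = k} = {\<omega> \<in> space M. \<forall>i\<le>n. X i \<omega> = x i}" by auto
      thus ?thesis using True by simp
    next
      case False
      hence "{\<omega> \<in> space M. (\<forall>i\<le>n. X i \<omega> = x i) \<and> X (n + 0) \<omega> = k} = {}" by auto
      thus ?thesis using False by (simp only: measure_empty if_False mult_zero_right)
    qed
    thus ?case using sums_single[of "x n" "\<lambda>k. real k * \<P>(\<omega> in M. \<forall>i\<le>n. X i \<omega> = x i)"]
      by (simp add: mult.commute)
  next
    case (Suc m)
    define A where "A = (\<lambda>\<omega>. \<forall>i\<le>n. X i \<omega> = x i)"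
    have [measurable]: "Measurable.pred M A" unfolding A_def by measurable
    \<comment> \<open>the bound used in the recursion for \<open>walk_mean\<close>\<close>
    define L where "L = x n + 1 + N"
    have path: "(\<forall>i\<le>Suc n. X i \<omega> = (x(Suc n := l)) i) \<longleftrightarrow> A \<omega> \<and> X (Suc n) \<omega> = l" for l \<omega>
      unfolding A_def by (auto simp: le_Suc_eq)
    have "AE \<omega> in M. \<not> (A \<omega> \<and> X (Suc n) \<omega> = l)" if "l > L" for l
    proof -
      have "walk_transition p (x n) l = 0"
        using that p_beyond[of l] by (auto simp: walk_transition_def L_def)
      hence "\<P>(\<omega> in M. A \<omega> \<and> X (Suc n) \<omega> = l) = 0"
        unfolding A_def prob_path_step by simp
      thus ?thesis by (subst (asm) prob_eq_0) auto
    qed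
    hence "AE \<omega> in M. \<forall>l. l > L \<longrightarrow> \<not> (A \<omega> \<and> X (Suc n) \<omega> = l)"
      by (subst AE_all_countable) auto
    hence ae: "AE \<omega> in M. A \<omega> \<longrightarrow> X (Suc n) \<omega> \<le> L"
      by eventually_elim (auto intro: leI)
    have split: "\<P>(\<omega> in M. A \<omega> \<and> X (n + Suc m) \<omega> = k) =
       (\<Sum>l\<le>L. \<P>(\<omega> in M. (A \<omega> \<and> X (Suc n) \<omega> = l) \<and> X (Suc n + m) \<omega> = k))" for k
      by (rule prob_sum) (use ae in auto)
    have step: "(\<lambda>k. real k * \<P>(\<omega> in M. (A \<omega> \<and> X (Suc n) \<omega> = l) \<and> X (Suc n + m) \<omega> = k)) sums
       (\<P>(\<omega> in M. A \<omega>) * walk_transition p (x n) l * walk_mean p N m l)" for l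
      using Suc[of "Suc n" "x(Suc n := l)"] unfolding path by (simp add: A_def prob_path_step)
    have "(\<lambda>k. \<Sum>l\<le>L. real k * \<P>(\<omega> in M. (A \<omega> \<and> X (Suc n) \<omega> = l) \<and> X (Suc n + m) \<omega> = k)) sums
       (\<Sum>l\<le>L. \<P>(\<omega> in M. A \<omega>) * walk_transition p (x n) l * walk_mean p N m l)"
      by (intro sums_sum step)
    also have "(\<lambda>k. \<Sum>l\<le>L. real k * \<P>(\<omega> in M. (A \<omega> \<and> X (Suc n) \<omega> = l) \<and> X (Suc n + m) \<omega> = k))
       = (\<lambda>k. real k * \<P>(\<omega> in M. A \<omega> \<and> X (n + Suc m) \<omega> = k))"
      unfolding split sum_distrib_left ..
    also have "(\<Sum>l\<le>L. \<P>(\<omega> in M. A \<omega>) * walk_transition p (x n) l * walk_mean p N m l)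
       = \<P>(\<omega> in M. A \<omega>) * walk_mean p N (Suc m) (x n)"
      by (simp only: L_def sum_distrib_left mult.assoc walk_mean.simps)
    finally show ?case unfolding A_def .
  qed
qed

lemma (in jump_law) expected_position_eq_walk_mean:
  assumes walk: "random_walk M X p" and start: "\<P>(\<omega> in M. X 0 \<omega> = j) > 0"
  shows "expected_position M X j n = walk_mean p N n j"
proof -
  let ?P0 = "\<P>(\<omega> in M. X 0 \<omega> = j)"
  from walk have "homogeneous_markov_chain M X (walk_transition p)" by (simp add: random_walk_def)
  from path_mean_sums[OF this, of 0 "\<lambda>_. j" n]
  have "(\<lambda>k. real k * \<P>(\<omega> in M. X 0 \<omega> = j \<and> X n \<omega> = k)) sums (?P0 * walk_mean p N n j)" by simp
  from sums_divide[OF this, of ?P0]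
  have "(\<lambda>k. real k * \<P>(\<omega> in M. X n \<omega> = k \<bar> X 0 \<omega> = j)) sums walk_mean p N n j"
    using start by (simp add: cond_prob_def conj_commute)
  thus ?thesis unfolding expected_position_def by (simp add: sums_iff)
qed

theorem theorem1:
  fixes p :: "nat \<Rightarrow> real" and M :: "'a measure" and X :: "nat \<Rightarrow> 'a \<Rightarrow> nat"
    and N j :: nat
  assumes p_nonneg: "\<And>k. p k \<ge> 0"
    and p_sums: "p sums 1"
    and walk: "random_walk M X p"
    and A1: "p 0 < 1"
    and A2: "\<exists>k. even k \<and> p k > 0"
    and A3: "N > 0" "\<And>k. k > N \<Longrightarrow> p k = 0"
    and A4: "rsquarefree (walk_poly p N)"
    and start: "\<P>(\<omega> in M. X 0 \<omega> = j) > 0"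
  shows "(\<lambda>n. expected_position M X j n -
      (2 / sqrt (2 * pi) * sqrt (real n)
       + (moment p 2 - 1) / (2 * moment p 1)
       + 1 / sqrt (2 * pi)
         * (1 / 3 - moment p 3 / (3 * moment p 1)
            + (moment p 2 - 1)\<^sup>2 / (2 * (moment p 1)\<^sup>2)
            - real j * ((moment p 2 - 1) / moment p 1)
            + (real j)\<^sup>2)
         * (1 / sqrt (real n))))
    \<in> O(\<lambda>n. 1 / real n powr (3 / 2))"
proof -
  interpret jump_law p N by unfold_locales (use assms in auto)
  show ?thesis unfolding expected_position_eq_walk_mean[OF walk start] by (rule walk_mean_asymp)
qed

end
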